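(* Every equicharacteristic complete local Noetherian commutative ring belongs to class (A); that is, if $R$ is an equicharacteristic complete local Noetherian commutative ring with maximal ideal $\mathfrak{m}$, then there is a field $\kappa\subseteq R$ such that every invertible element of $R$ can be written as $x+u$ with $x\in\mathfrak{m}$ and $u\in\kappa$.
   Context: Rings are unitary and subfields share the same $1$. A local ring $(R,\mathfrak{m})$ is equicharacteristic if $R$ has the same characteristic as its residue field $R/\mathfrak{m}$. Complete means complete (and separated) with respect to the $\mathfrak{m}$-adic topology. Class (A) consists of the local rings $(R,\mathfrak{m})$ for which there is a fixed field $\kappa\subseteq R$ such that every invertible element of $R$ can be written as $x+u$ with $x\in\mathfrak{m}$ and $u\in\kappa$. *)

theory Defs
  imports "HOL-Algebra.Algebra"
begin

section \<open>Local rings\<close>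

text \<open>Local rings need not be commutative, so locality is expressed through left ideals.
  The lemma \<open>local_ring_iff_maximalideal\<close> below shows that for commutative rings this is the
  usual condition on ideals.\<close>

definition left_ideal :: "'a set \<Rightarrow> ('a, 'b) ring_scheme \<Rightarrow> bool" where
  "left_ideal I R \<longleftrightarrow>
     additive_subgroup I R \<and> (\<forall>r\<in>carrier R. \<forall>a\<in>I. r \<otimes>\<^bsub>R\<^esub> a \<in> I)"

definition maximal_left_ideal :: "'a set \<Rightarrow> ('a, 'b) ring_scheme \<Rightarrow> bool" where
  "maximal_left_ideal I R \<longleftrightarrow>
     left_ideal I R \<and> I \<noteq> carrier R \<and>
     (\<forall>J. left_ideal J R \<and> I \<subseteq> J \<longrightarrow> J = I \<or> J = carrier R)"

locale local_ring = ring R for R (structure) and \<mm> +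
  assumes maximal: "maximal_left_ideal \<mm> R"
    and unique_maximal: "maximal_left_ideal I R \<Longrightarrow> I = \<mm>"

lemma (in cring) left_ideal_iff_ideal: "left_ideal I R \<longleftrightarrow> ideal I R"
proof
  assume I: "left_ideal I R"
  then interpret additive_subgroup I R by (simp add: left_ideal_def)
  have l: "r \<otimes> a \<in> I" if "r \<in> carrier R" "a \<in> I" for r a
    using I that by (simp add: left_ideal_def)
  have "a \<otimes> r \<in> I" if "r \<in> carrier R" "a \<in> I" for r a
    using l[OF that] that by (simp add: m_comm a_Hcarr)
  with l show "ideal I R"
    by (intro idealI ring_axioms a_subgroup)
next
  assume "ideal I R"
  then show "left_ideal I R"
    by (simp add: left_ideal_def ideal.axioms(1) ideal.I_l_closed)
qed

lemma (in cring) maximal_left_ideal_iff_maximalideal: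
  "maximal_left_ideal I R \<longleftrightarrow> maximalideal I R"
proof
  assume "maximal_left_ideal I R"
  then show "maximalideal I R"
    by (intro maximalidealI) (auto simp: maximal_left_ideal_def left_ideal_iff_ideal)
next
  assume I: "maximalideal I R"
  then interpret maximalideal I R .
  have "J = I \<or> J = carrier R" if "ideal J R" "I \<subseteq> J" for J
    using I_maximal[OF that] additive_subgroup.a_subset[OF ideal.axioms(1)[OF that(1)]] by simp
  then show "maximal_left_ideal I R"
    using ideal_axioms I_notcarr
    by (simp add: maximal_left_ideal_def left_ideal_iff_ideal)
qed

lemma (in cring) local_ring_iff_maximalideal:
  "local_ring R \<mm> \<longleftrightarrow> maximalideal \<mm> R \<and> (\<forall>I. maximalideal I R \<longrightarrow> I = \<mm>)"
  by (auto simp: local_ring_def local_ring_axioms_def ring_axioms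
        maximal_left_ideal_iff_maximalideal)


section \<open>Equicharacteristic local rings\<close>

definition characteristic :: "('a, 'b) ring_scheme \<Rightarrow> nat" where
  "characteristic R =
     (if \<exists>n::nat. n > 0 \<and> [n] \<cdot>\<^bsub>R\<^esub> \<one>\<^bsub>R\<^esub> = \<zero>\<^bsub>R\<^esub>
      then LEAST n::nat. n > 0 \<and> [n] \<cdot>\<^bsub>R\<^esub> \<one>\<^bsub>R\<^esub> = \<zero>\<^bsub>R\<^esub> else 0)"

definition equicharacteristic :: "('a, 'b) ring_scheme \<Rightarrow> 'a set \<Rightarrow> bool" where
  "equicharacteristic R \<mm> \<longleftrightarrow> characteristic R = characteristic (R Quot \<mm>)"


section \<open>Completeness for the adic topology\<close>

text \<open>The power of an ideal is taken in the monoid of ideals, whose unit is the whole ring.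
  The powers form a countable neighbourhood basis of zero in the adic topology, so completeness
  can be tested on sequences.\<close>

abbreviation ideal_power :: "('a, 'b) ring_scheme \<Rightarrow> 'a set \<Rightarrow> nat \<Rightarrow> 'a set" where
  "ideal_power R I n \<equiv> I [^]\<^bsub>ideals_set R\<^esub> n"

lemma ideal_power_0: "ideal_power R I 0 = carrier R"
  by (simp add: nat_pow_def ideals_set_def)

lemma ideal_power_Suc: "ideal_power R I (Suc n) = ideal_power R I n \<cdot>\<^bsub>R\<^esub> I"
  by (simp add: nat_pow_def ideals_set_def)

definition adic_Cauchy :: "('a, 'b) ring_scheme \<Rightarrow> 'a set \<Rightarrow> (nat \<Rightarrow> 'a) \<Rightarrow> bool" where
  "adic_Cauchy R I s \<longleftrightarrow>
     (\<forall>k. \<exists>N. \<forall>i\<ge>N. \<forall>j\<ge>N. s i \<ominus>\<^bsub>R\<^esub> s j \<in> ideal_power R I k)"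

definition adic_tendsto :: "('a, 'b) ring_scheme \<Rightarrow> 'a set \<Rightarrow> (nat \<Rightarrow> 'a) \<Rightarrow> 'a \<Rightarrow> bool" where
  "adic_tendsto R I s x \<longleftrightarrow> (\<forall>k. \<exists>N. \<forall>i\<ge>N. s i \<ominus>\<^bsub>R\<^esub> x \<in> ideal_power R I k)"

definition adically_separated :: "('a, 'b) ring_scheme \<Rightarrow> 'a set \<Rightarrow> bool" where
  "adically_separated R I \<longleftrightarrow> (\<Inter>n. ideal_power R I n) = {\<zero>\<^bsub>R\<^esub>}"

definition adically_complete :: "('a, 'b) ring_scheme \<Rightarrow> 'a set \<Rightarrow> bool" where
  "adically_complete R I \<longleftrightarrow>
     adically_separated R I \<and>
     (\<forall>s. range s \<subseteq> carrier R \<and> adic_Cauchy R I s \<longrightarrow>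
          (\<exists>x\<in>carrier R. adic_tendsto R I s x))"


section \<open>Class (A)\<close>

text \<open>A \<open>subfield\<close> contains the unit of the ambient ring.\<close>

definition class_A :: "('a, 'b) ring_scheme \<Rightarrow> 'a set \<Rightarrow> bool" where
  "class_A R \<mm> \<longleftrightarrow>
     local_ring R \<mm> \<and>
     (\<exists>\<kappa>. subfield \<kappa> R \<and> (\<forall>r\<in>Units R. \<exists>x\<in>\<mm>. \<exists>u\<in>\<kappa>. r = x \<oplus>\<^bsub>R\<^esub> u))"

end

theory Submission
  imports Defs
begin

text \<open>The coefficient field is obtained as the intersection of a decreasing chain of subrings
  \<open>A\<^sub>0 \<supseteq> A\<^sub>1 \<supseteq> \<dots>\<close> of \<open>R\<close> with \<open>A\<^sub>n \<inter> \<mm> = \<mm>\<^sup>n\<^sup>+\<^sup>1\<close> and \<open>A\<^sub>n + \<mm> = R\<close>. Completeness shows that the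
  intersection still meets every residue class: representatives \<open>s\<^sub>n \<in> A\<^sub>n\<close> of a fixed class form a
  Cauchy sequence. Separatedness shows that it meets \<open>\<mm>\<close> only in zero, hence is a field.

  Passing from \<open>A\<^sub>n\<close> to \<open>A\<^sub>n\<^sub>+\<^sub>1\<close> is the case of a local ring whose maximal ideal has square zero
  modulo an ideal \<open>J\<close>. There, Zorn's lemma gives a subring \<open>B\<close> maximal subject to
  \<open>B \<inter> \<mm> = J\<close>. In residue characteristic \<open>p\<close> it is chosen to contain all \<open>p\<close>-th powers; these
  form a subring that meets \<open>\<mm>\<close> inside \<open>J\<close>. A residue class not represented in \<open>B\<close> could
  be lifted to an element that generates a larger such subring.\<close>


section \<open>Polynomial expressions\<close>

lemma (in ring) ideal_add_cancel:
  assumes "ideal I R" and "x \<in> carrier R" and "y \<in> I" and "x \<oplus> y \<in> I"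
  shows "x \<in> I"
proof -
  interpret I: ideal I R by fact
  have "(x \<oplus> y) \<oplus> \<ominus> y \<in> I"
    using assms by (simp add: I.a_closed)
  then show ?thesis
    using assms by (simp add: a_assoc r_neg I.Icarr)
qed

text \<open>Elements of \<open>simple_extension K x\<close> arise by Horner steps
  \<open>k1 \<otimes> x \<oplus> k2\<close>. Induction on one factor therefore reduces products to
  sums, multiplication by \<open>x\<close> and multiplication by elements of
  \<open>K\<close>.\<close>

lemma (in cring) subring_simple_extension:
  assumes "subring K R" and x: "x \<in> carrier R"
  shows "subring (simple_extension K x) R"
proof -
  note K = subringE[OF assms(1)]
  let ?E = "simple_extension K x"
  have E: "a \<in> carrier R" if "a \<in> ?E" for a
    using simple_extension_in_carrier[OF K(1) x] that by blast
  have k: "a \<in> carrier R" if "a \<in> K" for a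
    using K(1) that by blast
  have add: "a \<oplus> b \<in> ?E" if "a \<in> ?E" "b \<in> ?E" for a b
    using that
  proof (induction a arbitrary: b rule: simple_extension.induct)
    case zero
    then show ?case using E by simp
  next
    case (lin k1 k2)
    from \<open>b \<in> ?E\<close> show ?case
    proof (cases rule: simple_extension.cases)
      case zero
      then show ?thesis
        using lin E k x by (auto intro: simple_extension.lin)
    next
      case (lin l1 l2)
      then have "k1 \<otimes> x \<oplus> k2 \<oplus> b = (k1 \<oplus> l1) \<otimes> x \<oplus> (k2 \<oplus> l2)"
        using E[OF \<open>k1 \<in> ?E\<close>] E[OF \<open>l1 \<in> ?E\<close>] k[OF \<open>k2 \<in> K\<close>] k[OF \<open>l2 \<in> K\<close>] x by algebra
      then show ?thesis
        using lin(2,3) \<open>k2 \<in> K\<close> \<open>\<And>b. b \<in> ?E \<Longrightarrow> k1 \<oplus> b \<in> ?E\<close>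
        by (simp add: simple_extension.lin K(7))
    qed
  qed
  have scale: "r \<otimes> a \<in> ?E" if "a \<in> ?E" "r \<in> K" for r a
    using that
  proof (induction rule: simple_extension.induct)
    case zero
    then show ?case using k by simp
  next
    case (lin k1 k2)
    then have "r \<otimes> (k1 \<otimes> x \<oplus> k2) = (r \<otimes> k1) \<otimes> x \<oplus> r \<otimes> k2"
      using E[OF \<open>k1 \<in> ?E\<close>] k[OF \<open>k2 \<in> K\<close>] k[OF \<open>r \<in> K\<close>] x by algebra
    then show ?case
      using lin by (simp add: simple_extension.lin K(6))
  qed
  have shift: "a \<otimes> x \<in> ?E" if "a \<in> ?E" for a
    using simple_extension.lin[OF that K(2)] E[OF that] x by simp
  have mult: "a \<otimes> b \<in> ?E" if "b \<in> ?E" "a \<in> ?E" for a b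
    using that
  proof (induction rule: simple_extension.induct)
    case zero
    then show ?case using E by simp
  next
    case (lin k1 k2)
    have "a \<otimes> (k1 \<otimes> x \<oplus> k2) = (a \<otimes> k1) \<otimes> x \<oplus> k2 \<otimes> a"
      using E[OF \<open>k1 \<in> ?E\<close>] k[OF \<open>k2 \<in> K\<close>] E[OF \<open>a \<in> ?E\<close>] x by algebra
    then show ?case
      using lin by (simp add: add shift scale)
  qed
  have one: "\<one> \<in> ?E"
    using simple_extension_incl[OF K(1) x] K(3) by blast
  have "\<ominus> a \<in> ?E" if "a \<in> ?E" for a
    using scale[OF that K(5)[OF K(3)]] E[OF that] by (simp add: l_minus)
  then show ?thesis
    using E one mult add by (intro subringI) auto
qed

section \<open>Evaluation of coefficient sequences\<close>

context ring
begin

text \<open>A polynomial of degree below \<open>n\<close> is kept as a total sequence with a length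
  and no normal form. Multiplying by the variable is then \<open>case_nat\<close>, and changing one
  coefficient is a function update.\<close>

primrec peval :: "(nat \<Rightarrow> 'a) \<Rightarrow> 'a \<Rightarrow> nat \<Rightarrow> 'a" where
  "peval c x 0 = \<zero>"
| "peval c x (Suc n) = peval c x n \<oplus> c n \<otimes> x [^] n"

lemma peval_closed [simp]:
  "range c \<subseteq> carrier R \<Longrightarrow> x \<in> carrier R \<Longrightarrow> peval c x n \<in> carrier R"
  by (induction n) (auto simp: image_subset_iff)

lemma peval_zero [simp]: "x \<in> carrier R \<Longrightarrow> peval (\<lambda>_. \<zero>) x n = \<zero>"
  by (induction n) auto

lemma peval_cong: "(\<And>i. i < n \<Longrightarrow> b i = c i) \<Longrightarrow> peval b x n = peval c x n"
  by (induction n) auto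

end

context cring
begin

text \<open>This translates between sums of powers and the Horner steps that generate
  \<open>simple_extension\<close>.\<close>

lemma peval_Suc_shift:
  assumes c: "range c \<subseteq> carrier R" and x: "x \<in> carrier R" and k: "k \<in> carrier R"
  shows "peval (case_nat k c) x (Suc n) = peval c x n \<otimes> x \<oplus> k"
proof (induction n)
  case 0
  then show ?case using x k by simp
next
  case (Suc n)
  have "c n \<in> carrier R" "x [^] n \<in> carrier R" "peval c x n \<in> carrier R"
    using c x by auto
  moreover have "peval (case_nat k c) x (Suc (Suc n)) =
    (peval c x n \<otimes> x \<oplus> k) \<oplus> c n \<otimes> (x [^] n \<otimes> x)"
    using Suc.IH by simp
  moreover have "peval c x (Suc n) = peval c x n \<oplus> c n \<otimes> x [^] n"
    by simp
  ultimately show ?case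
    using x k by algebra
qed

lemma peval_add_scaled:
  assumes b: "range b \<subseteq> carrier R" and c: "range c \<subseteq> carrier R"
    and x: "x \<in> carrier R" and r: "r \<in> carrier R"
  shows "peval (\<lambda>i. b i \<oplus> r \<otimes> c i) x n = peval b x n \<oplus> r \<otimes> peval c x n"
proof (induction n)
  case 0
  then show ?case using r by simp
next
  case (Suc n)
  have "c n \<in> carrier R" "b n \<in> carrier R" "x [^] n \<in> carrier R"
    "peval c x n \<in> carrier R" "peval b x n \<in> carrier R"
    using b c x by auto
  then show ?case
    using r by (simp only: peval.simps Suc.IH) algebra
qed

lemma peval_upd_0:
  assumes c: "range c \<subseteq> carrier R" and x: "x \<in> carrier R" and k: "k \<in> carrier R" and "n > 0"
  shows "peval (c(0 := c 0 \<oplus> k)) x n = peval c x n \<oplus> k"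
  using \<open>n > 0\<close>
proof (induction n rule: nat_induct_non_zero)
  case 1
  have "c 0 \<in> carrier R"
    using c by auto
  then show ?case using k by simp
next
  case (Suc n)
  have "c n \<in> carrier R" "x [^] n \<in> carrier R" "peval c x n \<in> carrier R"
    using c x by auto
  then show ?case
    using Suc k by (simp add: a_ac)
qed

lemma peval_delta_0:
  assumes x: "x \<in> carrier R" and k: "k \<in> carrier R" and "n > 0"
  shows "peval ((\<lambda>_. \<zero>)(0 := k)) x n = k"
  using \<open>n > 0\<close> x k by (induction n rule: nat_induct_non_zero) simp_all

lemma peval_mem_ideal:
  assumes "ideal I R" and "\<And>i. i < n \<Longrightarrow> c i \<in> I" and x: "x \<in> carrier R"
  shows "peval c x n \<in> I"
  using assms(2)
proof (induction n)
  case 0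
  then show ?case
    using assms(1) by (simp add: additive_subgroup.zero_closed ideal.axioms(1))
next
  case (Suc n)
  then show ?case
    using assms(1) x
    by (simp add: additive_subgroup.a_closed ideal.axioms(1) ideal.I_r_closed)
qed

lemma nat_pow_add_ideal:
  assumes "ideal I R" and x: "x \<in> carrier R" and h: "h \<in> I"
  shows "\<exists>j\<in>I. (x \<oplus> h) [^] n = x [^] (n::nat) \<oplus> j"
proof (induction n)
  interpret I: ideal I R by fact
  case 0
  then show ?case by (auto intro!: bexI[of _ \<zero>])
next
  interpret I: ideal I R by fact
  case (Suc n)
  then obtain j where j: "j \<in> I" "(x \<oplus> h) [^] n = x [^] n \<oplus> j" by blast
  have cl: "j \<in> carrier R" "h \<in> carrier R" "x [^] n \<in> carrier R"
    using j h x I.Icarr by auto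
  have "(x [^] n \<oplus> j) \<otimes> (x \<oplus> h) = x [^] n \<otimes> x \<oplus> (j \<otimes> x \<oplus> (x [^] n \<oplus> j) \<otimes> h)"
    using cl x by algebra
  moreover have "j \<otimes> x \<oplus> (x [^] n \<oplus> j) \<otimes> h \<in> I"
    using j(1) h cl x by (simp add: I.I_l_closed I.I_r_closed)
  ultimately show ?case
    using j(2) by auto
qed

lemma peval_add_ideal:
  assumes "ideal I R" and c: "range c \<subseteq> carrier R" and x: "x \<in> carrier R" and h: "h \<in> I"
  shows "\<exists>j\<in>I. peval c (x \<oplus> h) n = peval c x n \<oplus> j"
proof (induction n)
  interpret I: ideal I R by fact
  case 0
  then show ?case by (auto intro!: bexI[of _ \<zero>])
next
  interpret I: ideal I R by fact
  case (Suc n)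
  then obtain j where j: "j \<in> I" "peval c (x \<oplus> h) n = peval c x n \<oplus> j" by blast
  obtain i where i: "i \<in> I" "(x \<oplus> h) [^] n = x [^] n \<oplus> i"
    using nat_pow_add_ideal[OF assms(1) x h] by blast
  have cl: "j \<in> carrier R" "i \<in> carrier R" "x [^] n \<in> carrier R" "c n \<in> carrier R"
    "peval c x n \<in> carrier R"
    using j i x c I.Icarr by auto
  have "(peval c x n \<oplus> j) \<oplus> c n \<otimes> (x [^] n \<oplus> i) =
      (peval c x n \<oplus> c n \<otimes> x [^] n) \<oplus> (j \<oplus> c n \<otimes> i)"
    using cl by algebra
  moreover have "j \<oplus> c n \<otimes> i \<in> I"
    using j(1) i(1) cl by (simp add: I.I_l_closed)
  ultimately show ?case
    using j(2) i(2) by auto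
qed

text \<open>Every term of the expansion beyond the linear one contains \<open>h \<otimes> h\<close>
  and so lies in \<open>J\<close>. The exponent \<open>Suc n\<close> makes the derivative
  \<open>x [^] n\<close> expressible without subtraction.\<close>

lemma nat_pow_taylor:
  assumes "ideal J R" and x: "x \<in> carrier R" and h: "h \<in> carrier R" and hh: "h \<otimes> h \<in> J"
  shows "\<exists>j\<in>J. (x \<oplus> h) [^] Suc n = x [^] Suc n \<oplus> h \<otimes> (([Suc n] \<cdot> \<one>) \<otimes> x [^] n) \<oplus> j"
proof (induction n)
  interpret J: ideal J R by fact
  case 0
  then show ?case using x h by (auto intro!: bexI[of _ \<zero>])
next
  interpret J: ideal J R by fact
  case (Suc n)
  define N where "N = [Suc n] \<cdot> \<one>"
  define y where "y = x [^] n"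
  from Suc obtain j where j: "j \<in> J"
    "(x \<oplus> h) [^] Suc n = y \<otimes> x \<oplus> h \<otimes> (N \<otimes> y) \<oplus> j"
    unfolding N_def y_def by auto
  have cl: "j \<in> carrier R" "y \<in> carrier R" "N \<in> carrier R"
    using j x J.Icarr by (auto simp: y_def N_def)
  have "(y \<otimes> x \<oplus> h \<otimes> (N \<otimes> y) \<oplus> j) \<otimes> (x \<oplus> h) =
     (y \<otimes> x) \<otimes> x \<oplus> h \<otimes> ((N \<oplus> \<one>) \<otimes> (y \<otimes> x)) \<oplus> (j \<otimes> (x \<oplus> h) \<oplus> (N \<otimes> y) \<otimes> (h \<otimes> h))"
    using cl x h by algebra
  moreover have "j \<otimes> (x \<oplus> h) \<oplus> (N \<otimes> y) \<otimes> (h \<otimes> h) \<in> J"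
    using j(1) hh h cl x by (simp add: J.I_l_closed J.I_r_closed)
  moreover have "[Suc (Suc n)] \<cdot> \<one> = N \<oplus> \<one>"
    by (simp add: N_def)
  ultimately show ?case
    using j(2) by (auto simp: y_def)
qed

text \<open>The sequence multiplied by \<open>h\<close> lists the coefficients of the formal
  derivative, one fewer than in \<open>c\<close>.\<close>

lemma peval_taylor:
  assumes "ideal J R" and c: "range c \<subseteq> carrier R"
    and x: "x \<in> carrier R" and h: "h \<in> carrier R" and hh: "h \<otimes> h \<in> J"
  shows "\<exists>j\<in>J. peval c (x \<oplus> h) (Suc n) =
    peval c x (Suc n) \<oplus> h \<otimes> peval (\<lambda>i. ([Suc i] \<cdot> \<one>) \<otimes> c (Suc i)) x n \<oplus> j"
proof (induction n)
  interpret J: ideal J R by fact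
  case 0
  have "c 0 \<in> carrier R"
    using c by auto
  then show ?case using x h by (auto intro!: bexI[of _ \<zero>])
next
  interpret J: ideal J R by fact
  let ?d = "\<lambda>i. ([Suc i] \<cdot> \<one>) \<otimes> c (Suc i)"
  case (Suc n)
  define N where "N = [Suc n] \<cdot> \<one>"
  define y where "y = x [^] n"
  define z where "z = x [^] Suc n"
  define p where "p = peval c x (Suc n)"
  define q where "q = peval ?d x n"
  define e where "e = c (Suc n)"
  from Suc obtain j where j: "j \<in> J"
    "peval c (x \<oplus> h) (Suc n) = p \<oplus> h \<otimes> q \<oplus> j"
    unfolding p_def q_def by blast
  obtain i where i: "i \<in> J" "(x \<oplus> h) [^] Suc n = z \<oplus> h \<otimes> (N \<otimes> y) \<oplus> i"
    using nat_pow_taylor[OF assms(1) x h hh, of n] by (auto simp: N_def y_def z_def)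
  have "range ?d \<subseteq> carrier R"
    using c by auto
  then have cl: "j \<in> carrier R" "i \<in> carrier R" "y \<in> carrier R" "N \<in> carrier R"
    "e \<in> carrier R" "p \<in> carrier R" "q \<in> carrier R" "z \<in> carrier R"
    using j i x c J.Icarr unfolding y_def N_def e_def p_def q_def z_def
    by (auto simp del: peval.simps nat_pow_Suc)
  have "(p \<oplus> h \<otimes> q \<oplus> j) \<oplus> e \<otimes> (z \<oplus> h \<otimes> (N \<otimes> y) \<oplus> i) =
     (p \<oplus> e \<otimes> z) \<oplus> h \<otimes> (q \<oplus> N \<otimes> e \<otimes> y) \<oplus> (j \<oplus> e \<otimes> i)"
    using cl h by algebra
  moreover have "j \<oplus> e \<otimes> i \<in> J"
    using j(1) i(1) cl by (simp add: J.I_l_closed)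
  moreover have "peval c (x \<oplus> h) (Suc (Suc n)) =
      (p \<oplus> h \<otimes> q \<oplus> j) \<oplus> e \<otimes> (z \<oplus> h \<otimes> (N \<otimes> y) \<oplus> i)"
    unfolding peval.simps(2)[of c "x \<oplus> h" "Suc n"] j(2) i(2) e_def ..
  moreover have "peval c x (Suc (Suc n)) = p \<oplus> e \<otimes> z"
    unfolding peval.simps(2)[of c x "Suc n"] p_def e_def z_def ..
  moreover have "peval ?d x (Suc n) = q \<oplus> N \<otimes> e \<otimes> y"
    unfolding peval.simps(2) q_def e_def N_def y_def ..
  ultimately show ?case
    by metis
qed

lemma simple_extension_peval:
  assumes B: "subring B R" and a: "a \<in> carrier R" and y: "y \<in> simple_extension B a"
  shows "\<exists>c n. range c \<subseteq> B \<and> y = peval c a n"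
  using y
proof (induction rule: simple_extension.induct)
  case zero
  show ?case
    by (rule exI[of _ "\<lambda>_. \<zero>"], rule exI[of _ 0]) (use subringE(2)[OF B] in auto)
next
  case (lin k1 k2)
  then obtain c n where c: "range c \<subseteq> B" "k1 = peval c a n" by blast
  have "range (case_nat k2 c) \<subseteq> B"
    using c(1) lin(2) by (auto simp: image_subset_iff split: nat.split)
  moreover have "k1 \<otimes> a \<oplus> k2 = peval (case_nat k2 c) a (Suc n)"
    using peval_Suc_shift[of c a k2 n, OF _ a] c lin(2) subringE(1)[OF B]
    by (simp add: subset_iff del: peval.simps)
  ultimately show ?case by blast
qed

text \<open>This is division with remainder by the monic polynomial of degree \<open>e\<close> with
  root \<open>a\<close>, done one Horner step at a time: each step raises the length by one, and the
  relation brings it back to \<open>e\<close>.\<close>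

lemma simple_extension_peval_bounded:
  assumes B: "subring B R" and a: "a \<in> carrier R"
    and f: "range f \<subseteq> B" "a [^] e \<oplus> peval f a e = \<zero>" and e: "e > 0"
    and y: "y \<in> simple_extension B a"
  shows "\<exists>c. range c \<subseteq> B \<and> y = peval c a e"
  using y
proof (induction rule: simple_extension.induct)
  case zero
  have "peval (\<lambda>_. \<zero>) a e = \<zero>"
    using a by simp
  then show ?case
    by (intro exI[of _ "\<lambda>_. \<zero>"]) (use subringE(2)[OF B] in auto)
next
  case (lin k1 k2)
  note B' = subringE[OF B]
  obtain c where c: "range c \<subseteq> B" "k1 = peval c a e"
    using lin by blast
  define b where "b = case_nat k2 c"
  have b: "range b \<subseteq> B"
    using c(1) lin(2) by (auto simp: b_def image_subset_iff split: nat.split)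
  \<comment> \<open>Subtracting \<open>b e\<close> times the monic relation removes the leading
    coefficient \<open>b e\<close>.\<close>
  define g where "g = (\<lambda>i. b i \<oplus> (\<ominus> b e) \<otimes> f i)"
  have cl: "range b \<subseteq> carrier R" "range f \<subseteq> carrier R" "b e \<in> carrier R"
    using b f B'(1) by auto
  have "range g \<subseteq> B"
    using b f(1) B'(5-7) by (simp add: g_def image_subset_iff)
  moreover have "k1 \<otimes> a \<oplus> k2 = peval b a (Suc e)"
    using peval_Suc_shift[of c a k2 e, OF _ a] c lin(2) B'(1)
    by (simp add: b_def subset_iff del: peval.simps)
  moreover have "peval b a (Suc e) = peval b a e \<oplus> b e \<otimes> a [^] e"
    by simp
  moreover have "a [^] e = \<ominus> peval f a e"
    using f(2) minus_equality[of "a [^] e" "peval f a e"] cl a by simp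
  moreover have "peval g a e = peval b a e \<oplus> (\<ominus> b e) \<otimes> peval f a e"
    unfolding g_def using peval_add_scaled[OF cl(1,2) a] cl(3) by simp
  ultimately show ?case
    using cl a by (intro exI[of _ g]) (simp add: l_minus r_minus)
qed

end

section \<open>Square-zero thickenings\<close>

text \<open>The local ring \<open>R / J\<close> and its square-zero maximal ideal
  \<open>\<mm> / J\<close> are described inside \<open>R\<close>, so that no quotient ring has to be
  formed. Locality is expressed by \<open>unit\<close>.\<close>

locale square_zero_thickening = cring R + \<mm>: ideal \<mm> R + J: ideal J R
  for R (structure) and \<mm> J +
  assumes one_notin: "\<one> \<notin> \<mm>"
    and unit: "\<lbrakk>x \<in> carrier R; x \<notin> \<mm>\<rbrakk> \<Longrightarrow> x \<in> Units R"
    and J_subset: "J \<subseteq> \<mm>"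
    and square: "\<lbrakk>x \<in> \<mm>; y \<in> \<mm>\<rbrakk> \<Longrightarrow> x \<otimes> y \<in> J"
begin

text \<open>Modulo \<open>J\<close>, such a \<open>B\<close> is a subring of \<open>R / J\<close> that maps injectively into \<open>R / \<mm>\<close>.\<close>

definition lifting :: "'a set \<Rightarrow> bool" where
  "lifting B \<longleftrightarrow> subring B R \<and> J \<subseteq> B \<and> B \<inter> \<mm> \<subseteq> J"

lemma liftingD:
  assumes "lifting B"
  shows "subring B R" "J \<subseteq> B" "\<And>x. x \<in> B \<Longrightarrow> x \<in> \<mm> \<Longrightarrow> x \<in> J"
  using assms unfolding lifting_def by auto

lemma cancel_mem:
  assumes I: "ideal I R" and s: "s \<in> carrier R" "s \<notin> \<mm>" and x: "x \<in> carrier R" "s \<otimes> x \<in> I"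
  shows "x \<in> I"
proof -
  have "inv s \<otimes> (s \<otimes> x) = x"
    using unit[OF s] x(1) m_assoc[of "inv s" s x] s(1) by simp
  then show ?thesis
    using ideal.I_l_closed[OF I x(2), of "inv s"] unit[OF s] by simp
qed

lemma nat_pow_notin:
  assumes s: "s \<in> carrier R" "s \<notin> \<mm>"
  shows "s [^] (n::nat) \<notin> \<mm>"
proof (induction n)
  case (Suc n)
  have "s [^] Suc n = s \<otimes> s [^] n"
    using m_comm[OF s(1), of "s [^] n"] s(1) by simp
  then show ?case
    using cancel_mem[OF \<mm>.ideal_axioms s, of "s [^] n"] s(1) Suc by auto
qed (simp add: one_notin)

text \<open>Adjoining the inverse of \<open>s\<close> gives a larger lifting, since a power of \<open>s\<close> clears the denominators.\<close>

lemma maximal_lifting_inv: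
  assumes B: "lifting B" and max: "\<And>C. lifting C \<Longrightarrow> B \<subseteq> C \<Longrightarrow> C = B"
    and s: "s \<in> B" "s \<notin> \<mm>"
  shows "inv s \<in> B"
proof -
  note sub = liftingD(1)[OF B]
  note B' = subringE[OF sub]
  have sc: "s \<in> carrier R" and u: "s \<in> Units R" and ic: "inv s \<in> carrier R"
    using s B'(1) unit by auto
  have pow: "s [^] (n::nat) \<in> B" for n
    by (induction n) (use s B'(3,6) in auto)
  have bounded: "x \<in> carrier R \<and> (\<exists>n::nat. s [^] n \<otimes> x \<in> B)" if "x \<in> simple_extension B (inv s)" for x
    using that
  proof (induction rule: simple_extension.induct)
    case zero
    then show ?case using B'(2) by (auto intro!: exI[of _ 0])
  next
    case (lin k1 k2)
    then obtain n :: nat where n: "s [^] n \<otimes> k1 \<in> B" and k1: "k1 \<in> carrier R" by blast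
    define t where "t = s [^] n"
    have k2: "k2 \<in> carrier R" and t: "t \<in> carrier R"
      using lin B'(1) sc by (auto simp: t_def)
    have "(t \<otimes> s) \<otimes> (k1 \<otimes> inv s \<oplus> k2) = (t \<otimes> k1) \<otimes> (s \<otimes> inv s) \<oplus> t \<otimes> s \<otimes> k2"
      using k1 k2 sc ic t by algebra
    also have "\<dots> = t \<otimes> k1 \<oplus> t \<otimes> s \<otimes> k2"
      using u k1 t by simp
    also have "\<dots> \<in> B"
      using n pow lin(2) s B'(6,7) by (simp add: t_def)
    finally have "s [^] Suc n \<otimes> (k1 \<otimes> inv s \<oplus> k2) \<in> B"
      by (simp add: t_def)
    then show ?case
      using k1 k2 ic by blast
  qed
  have "lifting (simple_extension B (inv s))"
    unfolding lifting_def
  proof (intro conjI subsetI)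
    show "subring (simple_extension B (inv s)) R"
      by (rule subring_simple_extension[OF sub ic])
    show "x \<in> simple_extension B (inv s)" if "x \<in> J" for x
      using that liftingD(2)[OF B] simple_extension_incl[OF B'(1) ic] by blast
    fix x assume x: "x \<in> simple_extension B (inv s) \<inter> \<mm>"
    then obtain n :: nat where n: "s [^] n \<otimes> x \<in> B" and xc: "x \<in> carrier R"
      using bounded by blast
    have "s [^] n \<otimes> x \<in> J"
      using liftingD(3)[OF B n] x \<mm>.I_l_closed[of x "s [^] n"] sc by simp
    then show "x \<in> J"
      using cancel_mem[OF J.ideal_axioms _ nat_pow_notin[OF sc s(2)] xc] sc by simp
  qed
  then have "simple_extension B (inv s) = B"
    using max simple_extension_incl[OF B'(1) ic] by blast
  then show ?thesis
    using simple_extension_mem[OF sub ic] by simp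
qed

text \<open>Coefficients from \<open>B\<close> that lie in \<open>\<mm>\<close> already lie in
  \<open>J\<close>, and then so does the value of the polynomial. It thus suffices to find, for each
  element of the extension in \<open>\<mm>\<close>, one expression of this kind.\<close>

lemma lifting_simple_extension:
  assumes B: "lifting B" and a: "a \<in> carrier R"
    and E: "\<And>y. y \<in> simple_extension B a \<Longrightarrow> y \<in> \<mm> \<Longrightarrow>
      \<exists>c n. range c \<subseteq> B \<and> y = peval c a n \<and> (\<forall>i<n. c i \<in> \<mm>)"
  shows "lifting (simple_extension B a)"
  unfolding lifting_def
proof (intro conjI subsetI)
  note B' = subringE[OF liftingD(1)[OF B]]
  show "subring (simple_extension B a) R"
    by (rule subring_simple_extension[OF liftingD(1)[OF B] a])
  show "x \<in> simple_extension B a" if "x \<in> J" for x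
    using that liftingD(2)[OF B] simple_extension_incl[OF B'(1) a] by blast
  fix y assume "y \<in> simple_extension B a \<inter> \<mm>"
  then obtain c n where c: "range c \<subseteq> B" "y = peval c a n" "\<forall>i<n. c i \<in> \<mm>"
    using E by blast
  then have "c i \<in> J" if "i < n" for i
    using liftingD(3)[OF B] that by blast
  then show "y \<in> J"
    using peval_mem_ideal[OF J.ideal_axioms _ a] c(2) by blast
qed

end

section \<open>Maximal liftings and residue classes\<close>

context square_zero_thickening
begin

text \<open>In the residue ring, the class of \<open>a\<close> is a root of a nonzero polynomial of
  degree less than \<open>n\<close> over the image of \<open>B\<close>. Since \<open>n\<close>
  counts coefficients, the least \<open>n\<close> exceeds the minimal degree by one.\<close>

definition has_relation :: "'a set \<Rightarrow> 'a \<Rightarrow> nat \<Rightarrow> bool" where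
  "has_relation B a n \<longleftrightarrow> (\<exists>c. range c \<subseteq> B \<and> peval c a n \<in> \<mm> \<and> (\<exists>i<n. c i \<notin> \<mm>))"

text \<open>If the residue class of \<open>a\<close> satisfies no relation over \<open>B\<close>, then \<open>B[a]\<close> is again a lifting.
  Otherwise take a shortest relation, made monic of degree \<open>e\<close>. If some \<open>a + h\<close> with
  \<open>h \<in> \<mm>\<close> is an exact root of a monic polynomial of degree \<open>e\<close> over \<open>B\<close>, then \<open>B[a + h]\<close> is a
  lifting, because a relation shorter than the minimal one has all its coefficients in \<open>J\<close>.
  When \<open>e\<close> is invertible the derivative is a unit at \<open>a\<close> by minimality, and a single Newton step
  is exact modulo \<open>J\<close>. When \<open>e\<close> lies in \<open>\<mm>\<close>, minimality forces \<open>e = p\<close>, and \<open>a\<close> itself is a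
  root of the polynomial \<open>T\<^sup>p - a\<^sup>p\<close>.\<close>

lemma maximal_lifting_surj:
  assumes B: "lifting B" and max: "\<And>C. lifting C \<Longrightarrow> B \<subseteq> C \<Longrightarrow> C = B"
    and pow: "\<And>d::nat. d > 0 \<Longrightarrow> [d] \<cdot> \<one> \<in> \<mm> \<Longrightarrow>
      \<exists>p>0. p \<le> d \<and> (\<forall>x\<in>carrier R. x [^] p \<in> B)"
    and a: "a \<in> carrier R"
  shows "\<exists>x\<in>\<mm>. \<exists>b\<in>B. a = x \<oplus> b"
proof -
  note sub = liftingD(1)[OF B]
  note B' = subringE[OF sub]
  note JB = liftingD(2)[OF B]
  have Bc: "x \<in> carrier R" if "x \<in> B" for x
    using that B'(1) by blast
  have Brange: "range c \<subseteq> carrier R" if "range c \<subseteq> B" for c :: "nat \<Rightarrow> 'a"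
    using that B'(1) by blast
  \<comment> \<open>By maximality it is enough to find \<open>h\<close> in \<open>\<mm>\<close> such
    that adjoining \<open>a \<oplus> h\<close> gives a lifting.\<close>
  have absorb: "b \<in> B" if "b \<in> carrier R" "lifting (simple_extension B b)" for b
    using max[OF that(2)] simple_extension_incl[OF B'(1) that(1)]
      simple_extension_mem[OF sub that(1)] by simp
  have "\<exists>h\<in>\<mm>. a \<oplus> h \<in> B"
  proof (cases "\<exists>n. has_relation B a n")
    case False
    have "lifting (simple_extension B a)"
    proof (rule lifting_simple_extension[OF B a])
      fix y assume y: "y \<in> simple_extension B a" "y \<in> \<mm>"
      then obtain c n where "range c \<subseteq> B" "y = peval c a n"
        using simple_extension_peval[OF sub a] by blast
      then show "\<exists>c n. range c \<subseteq> B \<and> y = peval c a n \<and> (\<forall>i<n. c i \<in> \<mm>)"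
        using False y(2) unfolding has_relation_def by blast
    qed
    then show ?thesis
      using absorb[OF a] a by (auto intro!: bexI[of _ \<zero>])
  next
    case True
    define d where "d = (LEAST n. has_relation B a n)"
    have least: "\<not> has_relation B a n" if "n < d" for n
      using that not_less_Least unfolding d_def by blast
    have d: "has_relation B a d"
      using LeastI_ex[OF True] unfolding d_def .
    then obtain c i where c: "range c \<subseteq> B" "peval c a d \<in> \<mm>" "i < d" "c i \<notin> \<mm>"
      unfolding has_relation_def by blast
    then obtain e where e: "d = Suc e"
      by (cases d) auto
    have ce: "c e \<in> B" "c e \<in> carrier R"
      using c(1) Bc by auto
    \<comment> \<open>A leading coefficient in \<open>\<mm>\<close> could be dropped, leaving a
      shorter relation.\<close>
    have unit_ce: "c e \<notin> \<mm>"
    proof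
      assume m: "c e \<in> \<mm>"
      then have "c e \<otimes> a [^] e \<in> \<mm>"
        using a by (simp add: \<mm>.I_r_closed)
      moreover have "peval c a e \<oplus> c e \<otimes> a [^] e \<in> \<mm>"
        using c(2) e by simp
      ultimately have "peval c a e \<in> \<mm>"
        using ideal_add_cancel[OF \<mm>.ideal_axioms peval_closed[OF Brange[OF c(1)] a]] by blast
      moreover have "i < e"
        using c(3,4) e m by (cases "i = e") auto
      ultimately have "has_relation B a e"
        using c(1,4) unfolding has_relation_def by blast
      then show False
        using least e by simp
    qed
    \<comment> \<open>A relation of length one would say that its only coefficient
      \<open>c 0\<close> lies in \<open>\<mm>\<close>.\<close>
    have e0: "e > 0"
    proof (rule ccontr)
      assume "\<not> e > 0"
      then have "c e \<in> \<mm>"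
        using c(2) ce e by simp
      then show False
        using unit_ce by simp
    qed
    define u where "u = inv (c e)"
    have u: "u \<in> B" "u \<otimes> c e = \<one>"
      using maximal_lifting_inv[OF B max ce(1) unit_ce] unit[OF ce(2) unit_ce]
      by (auto simp: u_def)
    \<comment> \<open>Below index \<open>e\<close> these are the coefficients of the relation made
      monic. The summand \<open>\<zero>\<close> gives them the shape of
      \<open>peval_add_scaled\<close>.\<close>
    define f where "f = (\<lambda>i. \<zero> \<oplus> u \<otimes> c i)"
    have f: "range f \<subseteq> B"
      using c(1) u(1) B'(2,6,7) by (auto simp: f_def)
    have "peval f a e = u \<otimes> peval c a e"
      using peval_add_scaled[of "\<lambda>_. \<zero>" c a u e] Brange[OF c(1)] Bc[OF u(1)] a
      by (auto simp: f_def)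
    moreover have "u \<otimes> peval c a (Suc e) = u \<otimes> peval c a e \<oplus> (u \<otimes> c e) \<otimes> a [^] e"
      using Brange[OF c(1)] Bc[OF u(1)] a ce(2) by (simp add: r_distr m_assoc)
    ultimately have "peval f a e \<oplus> a [^] e = u \<otimes> peval c a (Suc e)"
      using u(2) a by simp
    then have rel: "peval f a e \<oplus> a [^] e \<in> \<mm>"
      using c(2) e Bc[OF u(1)] \<mm>.I_l_closed by metis
    have "\<exists>h\<in>\<mm>. \<exists>g. range g \<subseteq> B \<and> (a \<oplus> h) [^] e \<oplus> peval g (a \<oplus> h) e = \<zero>"
    proof (cases "[e] \<cdot> \<one> \<in> \<mm>")
      case True
      then obtain p where p: "p > 0" "p \<le> e" "a [^] p \<in> B"
        using pow[OF e0] a by blast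
      define k where "k = (\<lambda>_::nat. \<zero>)(0 := \<ominus> (a [^] p))"
      have k: "range k \<subseteq> B"
        using B'(2,5) p(3) by (auto simp: k_def)
      have kp: "peval k a p = \<ominus> (a [^] p)"
        using peval_delta_0[OF a _ p(1)] a by (simp add: k_def)
      \<comment> \<open>If \<open>p < e\<close>, the polynomial \<open>T^p - a^p\<close>, whose
        leading coefficient is \<open>\<one>\<close>, would be a relation of length
        \<open>Suc p\<close>, below the minimum \<open>d = Suc e\<close>.\<close>
      have "p = e"
      proof (rule ccontr)
        assume "p \<noteq> e"
        then have "Suc p < d"
          using p(2) e by simp
        have "peval (k(p := \<one>)) a p = peval k a p"
          by (rule peval_cong) simp
        then have "peval (k(p := \<one>)) a (Suc p) = \<zero>"
          using kp a by (simp add: l_neg)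
        moreover have "range (k(p := \<one>)) \<subseteq> B"
          using k B'(3) by auto
        ultimately have "has_relation B a (Suc p)"
          using one_notin unfolding has_relation_def
          by (intro exI[of _ "k(p := \<one>)"]) (auto intro!: exI[of _ p] simp del: peval.simps)
        then show False
          using least[OF \<open>Suc p < d\<close>] by simp
      qed
      then show ?thesis
        using kp k a by (intro bexI[of _ \<zero>] exI[of _ k]) (auto simp: r_neg)
    next
      case False
      define F where "F = f(e := \<one>)"
      define v where "v = peval F a (Suc e)"
      define \<delta> where "\<delta> = (\<lambda>i. ([Suc i] \<cdot> \<one>) \<otimes> F (Suc i))"
      define D where "D = peval \<delta> a e"
      have F: "range F \<subseteq> B"
        using f B'(3) by (auto simp: F_def)
      have FS: "peval F x (Suc e) = peval f x e \<oplus> x [^] e" if "x \<in> carrier R" for x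
        using peval_cong[of e F f x] that by (simp add: F_def)
      have numB: "[n] \<cdot> \<one> \<in> B" for n :: nat
        by (induction n) (use B'(2,3,7) in auto)
      have \<delta>: "range \<delta> \<subseteq> B"
        using numB F B'(6) by (auto simp: \<delta>_def simp del: add.nat_pow_Suc)
      have D: "D \<in> carrier R" "D \<notin> \<mm>"
      proof -
        show "D \<in> carrier R"
          using Brange[OF \<delta>] a by (simp add: D_def)
        \<comment> \<open>The derivative has leading coefficient \<open>[e] \<cdot> \<one>\<close>
          outside \<open>\<mm>\<close>. If its value \<open>D\<close> were in \<open>\<mm>\<close>,
          it would be a relation of length \<open>e < d\<close>.\<close>
        have "\<delta> (e - 1) = [e] \<cdot> \<one>"
          using e0 by (cases e) (simp_all add: \<delta>_def F_def)
        then show "D \<notin> \<mm>"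
          using least[of e] False e0 e \<delta> unfolding has_relation_def D_def
          by (metis diff_less lessI zero_less_one)
      qed
      \<comment> \<open>The Newton correction is chosen so that
        \<open>v \<oplus> h \<otimes> D = \<zero>\<close>.\<close>
      define h where "h = \<ominus> (v \<otimes> inv D)"
      have v: "v \<in> \<mm>"
        using rel FS[OF a] by (simp add: v_def)
      have iD: "inv D \<in> carrier R" "inv D \<otimes> D = \<one>"
        using unit[OF D] by auto
      have h: "h \<in> \<mm>"
        using v iD by (simp add: h_def \<mm>.I_r_closed)
      have hc: "h \<in> carrier R" "v \<in> carrier R"
        using h v \<mm>.Icarr by auto
      obtain j where j: "j \<in> J" "peval F (a \<oplus> h) (Suc e) = v \<oplus> h \<otimes> D \<oplus> j"
        using peval_taylor[OF J.ideal_axioms Brange[OF F] a hc(1) square[OF h h], of e]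
        unfolding v_def D_def \<delta>_def by blast
      have "h \<otimes> D = \<ominus> v"
        using iD hc D(1) by (simp add: h_def l_minus m_assoc)
      then have jeq: "peval f (a \<oplus> h) e \<oplus> (a \<oplus> h) [^] e = j"
        using j FS[of "a \<oplus> h"] a hc J.Icarr[OF j(1)] by (simp add: r_neg)
      \<comment> \<open>The remaining error \<open>j\<close> lies in \<open>J\<close>, hence in
        \<open>B\<close>, and can be absorbed into the constant coefficient. This turns a root
        modulo \<open>J\<close> into an exact root.\<close>
      define g where "g = f(0 := f 0 \<oplus> \<ominus> j)"
      have "f 0 \<oplus> \<ominus> j \<in> B"
        using f j(1) JB by (intro B'(5,7)) auto
      then have "range g \<subseteq> B"
        using f by (auto simp: g_def)
      moreover have "peval g (a \<oplus> h) e = peval f (a \<oplus> h) e \<oplus> \<ominus> j"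
        using peval_upd_0[OF Brange[OF f] _ _ e0] a hc(1) J.Icarr[OF j(1)] by (simp add: g_def)
      then have "(a \<oplus> h) [^] e \<oplus> peval g (a \<oplus> h) e
          = (peval f (a \<oplus> h) e \<oplus> (a \<oplus> h) [^] e) \<oplus> \<ominus> j"
        using Brange[OF f] a hc(1) J.Icarr[OF j(1)] by (simp add: a_ac)
      then have "(a \<oplus> h) [^] e \<oplus> peval g (a \<oplus> h) e = \<zero>"
        using jeq J.Icarr[OF j(1)] by (simp add: r_neg)
      ultimately show ?thesis
        using h by blast
    qed
    then obtain h g where h: "h \<in> \<mm>" and g: "range g \<subseteq> B"
      "(a \<oplus> h) [^] e \<oplus> peval g (a \<oplus> h) e = \<zero>"
      by blast
    have ah: "a \<oplus> h \<in> carrier R"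
      using a \<mm>.Icarr[OF h] by simp
    have "lifting (simple_extension B (a \<oplus> h))"
    proof (rule lifting_simple_extension[OF B ah])
      fix y assume y: "y \<in> simple_extension B (a \<oplus> h)" "y \<in> \<mm>"
      then obtain c where c: "range c \<subseteq> B" "y = peval c (a \<oplus> h) e"
        using simple_extension_peval_bounded[OF sub ah g e0] by blast
      \<comment> \<open>Replacing \<open>a \<oplus> h\<close> by \<open>a\<close> changes the value
        only by an element of \<open>\<mm>\<close>. The minimality of \<open>d\<close>, stated at
        \<open>a\<close>, therefore forces all coefficients below \<open>e\<close> into
        \<open>\<mm>\<close>.\<close>
      obtain j where "j \<in> \<mm>" "peval c (a \<oplus> h) e = peval c a e \<oplus> j"
        using peval_add_ideal[OF \<mm>.ideal_axioms Brange[OF c(1)] a h] by blast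
      then have "peval c a e \<in> \<mm>"
        using ideal_add_cancel[OF \<mm>.ideal_axioms, of "peval c a e" j] c y(2) Brange[OF c(1)] a
        by simp
      then show "\<exists>c n. range c \<subseteq> B \<and> y = peval c (a \<oplus> h) n \<and> (\<forall>i<n. c i \<in> \<mm>)"
        using least[of e] e c unfolding has_relation_def by blast
    qed
    then show ?thesis
      using absorb[OF ah] h by blast
  qed
  then obtain h where h: "h \<in> \<mm>" "a \<oplus> h \<in> B" by blast
  have "a = \<ominus> h \<oplus> (a \<oplus> h)"
    using a \<mm>.Icarr[OF h(1)] by algebra
  then show ?thesis
    using h by blast
qed

text \<open>Zorn's lemma applies because any two elements of the union of a chain lie in a common
  member, so the union is again a lifting.\<close>

lemma ex_maximal_lifting:
  assumes P: "lifting P"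
  shows "\<exists>B. lifting B \<and> P \<subseteq> B \<and> (\<forall>C. lifting C \<longrightarrow> B \<subseteq> C \<longrightarrow> C = B)"
proof -
  let ?F = "{B. lifting B \<and> P \<subseteq> B}"
  have "\<exists>M\<in>?F. \<forall>N\<in>?F. M \<subseteq> N \<longrightarrow> N = M"
  proof (rule subset_Zorn_nonempty)
    show "?F \<noteq> {}"
      using P by blast
    fix \<C> assume ne: "\<C> \<noteq> {}" and ch: "subset.chain ?F \<C>"
    have L: "lifting B" "P \<subseteq> B" if "B \<in> \<C>" for B
      using ch that unfolding pred_on.chain_def by auto
    note sub = liftingD(1)[OF L(1)]
    have pair: "\<exists>B\<in>\<C>. x \<in> B \<and> y \<in> B" if "x \<in> \<Union>\<C>" "y \<in> \<Union>\<C>" for x y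
      using ch that unfolding pred_on.chain_def by blast
    have "subring (\<Union>\<C>) R"
    proof (rule subringI)
      show "\<Union>\<C> \<subseteq> carrier R"
        using subringE(1)[OF sub] by blast
      show "\<one> \<in> \<Union>\<C>"
        using ne subringE(3)[OF sub] by blast
      show "\<ominus> x \<in> \<Union>\<C>" if "x \<in> \<Union>\<C>" for x
        using that subringE(5)[OF sub] by blast
      show "x \<otimes> y \<in> \<Union>\<C>" if "x \<in> \<Union>\<C>" "y \<in> \<Union>\<C>" for x y
        using pair[OF that] subringE(6)[OF sub] by blast
      show "x \<oplus> y \<in> \<Union>\<C>" if "x \<in> \<Union>\<C>" "y \<in> \<Union>\<C>" for x y
        using pair[OF that] subringE(7)[OF sub] by blast
    qed
    moreover have "J \<subseteq> \<Union>\<C>" "P \<subseteq> \<Union>\<C>"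
      using ne L(2) liftingD(2)[OF L(1)] by blast+
    moreover have "\<Union>\<C> \<inter> \<mm> \<subseteq> J"
      using liftingD(3)[OF L(1)] by blast
    ultimately show "\<Union>\<C> \<in> ?F"
      unfolding lifting_def by simp
  qed
  then obtain M where M: "M \<in> ?F" "\<forall>N\<in>?F. M \<subseteq> N \<longrightarrow> N = M"
    by (elim bexE)
  have "C = M" if "lifting C" "M \<subseteq> C" for C
  proof -
    have "P \<subseteq> C"
      using M(1) that(2) by auto
    then show ?thesis
      using bspec[OF M(2), of C] that by simp
  qed
  then show ?thesis
    using M(1) by (intro exI[of _ M]) simp
qed

end

section \<open>Binomial expansion and the Frobenius map\<close>

lemma (in cring) binomial_peval:
  assumes x: "x \<in> carrier R" and y: "y \<in> carrier R"
  shows "(x \<oplus> y) [^] n = peval (\<lambda>k. ([(n choose k)] \<cdot> \<one>) \<otimes> y [^] (n - k)) x (Suc n)"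
proof (induction n)
  case 0
  then show ?case using x by simp
next
  case (Suc n)
  let ?b = "\<lambda>n k. ([(n choose k)] \<cdot> \<one>) \<otimes> y [^] (n - k)"
  let ?P = "peval (?b n) x (Suc n)"
  have b: "range (?b n) \<subseteq> carrier R" for n
    using y by auto
  have s: "range (case_nat \<zero> (?b n)) \<subseteq> carrier R"
    using y by (auto simp: image_subset_iff split: nat.split)
  have P: "?P \<in> carrier R"
    using b x by (simp del: peval.simps)
  \<comment> \<open>Pascal's rule: the shifted sequence comes from multiplication by
    \<open>x\<close>, the scaled one from multiplication by \<open>y\<close>.\<close>
  have coeff: "case_nat \<zero> (?b n) k \<oplus> y \<otimes> ?b n k = ?b (Suc n) k" if "k < Suc (Suc n)" for k
  proof (cases k)
    case 0
    then show ?thesis using y by (simp add: m_comm)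
  next
    case (Suc j)
    have "y \<otimes> ?b n k = ([(n choose k)] \<cdot> \<one>) \<otimes> y [^] (n - j)"
    \<comment> \<open>For \<open>k = Suc n\<close> the truncated difference \<open>n - k\<close>
      yields a wrong exponent, but the binomial coefficient in front of it is zero.\<close>
    proof (cases "k \<le> n")
      case True
      then have "n - j = Suc (n - k)"
        using Suc by simp
      then show ?thesis
        using y by (simp add: m_ac)
    qed (use y in \<open>simp add: binomial_eq_0\<close>)
    then show ?thesis
      using y Suc
      by (simp add: add.nat_pow_mult[symmetric] l_distr[symmetric] a_comm del: add.nat_pow_mult)
  qed
  \<comment> \<open>Padding with the vanishing coefficient at \<open>Suc n\<close> gives both sums
    the same length.\<close>
  have "?P = peval (?b n) x (Suc (Suc n))"
    using P x y by (subst (2) peval.simps(2)) (simp add: binomial_eq_0 del: peval.simps)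
  then have "y \<otimes> ?P = y \<otimes> peval (?b n) x (Suc (Suc n))"
    by simp
  moreover have "?P \<otimes> x = peval (case_nat \<zero> (?b n)) x (Suc (Suc n))"
    using peval_Suc_shift[OF b x zero_closed, of n "Suc n"] P x by (simp del: peval.simps)
  ultimately have "?P \<otimes> x \<oplus> y \<otimes> ?P
      = peval (\<lambda>k. case_nat \<zero> (?b n) k \<oplus> y \<otimes> ?b n k) x (Suc (Suc n))"
    using peval_add_scaled[OF s b x y, of n "Suc (Suc n)"] by simp
  also have "\<dots> = peval (?b (Suc n)) x (Suc (Suc n))"
    by (rule peval_cong) (rule coeff)
  finally have "?P \<otimes> x \<oplus> y \<otimes> ?P = peval (?b (Suc n)) x (Suc (Suc n))" .
  moreover have "(x \<oplus> y) [^] Suc n = ?P \<otimes> x \<oplus> y \<otimes> ?P"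
    by (simp only: nat_pow_Suc Suc.IH r_distr[OF x y P] m_comm[OF P y])
  ultimately show ?case
    by simp
qed

lemma (in ring) add_pow_one_mult:
  "([m] \<cdot> \<one>) \<otimes> ([n] \<cdot> \<one>) = [(m * n :: nat)] \<cdot> \<one>"
  by (simp add: add_pow_ldistr add.nat_pow_pow mult.commute)

text \<open>The prime \<open>p\<close> divides all binomial coefficients strictly between the ends,
  so only the two pure powers survive.\<close>

lemma (in cring) frobenius_add:
  assumes p: "Factorial_Ring.prime p" "[p] \<cdot> \<one> = \<zero>" and x: "x \<in> carrier R" and y: "y \<in> carrier R"
  shows "(x \<oplus> y) [^] p = x [^] p \<oplus> y [^] (p::nat)"
proof -
  have p0: "p > 0"
    using p(1) by (simp add: prime_gt_0_nat)
  let ?b = "\<lambda>k. ([(p choose k)] \<cdot> \<one>) \<otimes> y [^] (p - k)"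
  have "?b k = ((\<lambda>_. \<zero>)(0 := y [^] p)) k" if "k < p" for k
  proof (cases "k = 0")
    case False
    then have "p dvd (p choose k)"
      using dvd_choose_prime[of k p] p(1) p0 that by simp
    then obtain m where "p choose k = p * m"
      by (elim dvdE)
    then have "[(p choose k)] \<cdot> \<one> = \<zero>"
      using add_pow_one_mult[of p m] p(2) by simp
    then show ?thesis using False y by simp
  qed (use y in simp)
  then have "peval ?b x p = peval ((\<lambda>_. \<zero>)(0 := y [^] p)) x p"
    by (rule peval_cong)
  also have "\<dots> = y [^] p"
    using peval_delta_0[OF x _ p0] y by blast
  finally have "peval ?b x p = y [^] p" .
  then show ?thesis
    using binomial_peval[OF x y, of p] x y by (simp add: a_comm)
qed

lemma (in cring) subring_nat_pow_image:
  assumes p: "Factorial_Ring.prime (p::nat)" "[p] \<cdot> \<one> = \<zero>"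
  shows "subring ((\<lambda>x. x [^] p) ` carrier R) R"
proof -
  have "(\<lambda>x. x [^] p) \<in> ring_hom R R"
    using frobenius_add[OF p] by (intro ring_hom_memI) (auto simp: nat_pow_distrib)
  then interpret ring_hom_ring R R "\<lambda>x. x [^] p"
    by (intro ring_hom_ringI2) (rule ring_axioms)+
  show ?thesis
    using img_is_subring[OF carrier_is_subring] .
qed

lemma (in ring) subring_range_int:
  "subring (range (\<lambda>n::int. [n] \<cdot> \<one>)) R"
proof (rule subringI)
  show "\<one> \<in> range (\<lambda>n::int. [n] \<cdot> \<one>)"
    by (rule range_eqI[of _ _ 1]) simp
  fix a b assume "a \<in> range (\<lambda>n::int. [n] \<cdot> \<one>)" "b \<in> range (\<lambda>n::int. [n] \<cdot> \<one>)"
  then obtain m n :: int where ab: "a = [m] \<cdot> \<one>" "b = [n] \<cdot> \<one>"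
    by blast
  show "a \<oplus> b \<in> range (\<lambda>n::int. [n] \<cdot> \<one>)"
    by (rule range_eqI[of _ _ "m + n"]) (simp add: ab add.int_pow_mult)
  show "a \<otimes> b \<in> range (\<lambda>n::int. [n] \<cdot> \<one>)"
    by (rule range_eqI[of _ _ "n * m"]) (simp add: ab add_pow_ldistr_int add.int_pow_pow)
next
  fix a assume "a \<in> range (\<lambda>n::int. [n] \<cdot> \<one>)"
  then obtain m :: int where a: "a = [m] \<cdot> \<one>"
    by blast
  show "\<ominus> a \<in> range (\<lambda>n::int. [n] \<cdot> \<one>)"
    by (rule range_eqI[of _ _ "- m"]) (simp add: a add.int_pow_neg)
qed auto

lemma (in ring) subring_add_ideal:
  assumes "subring K R" "ideal J R"
  shows "subring (K <+>\<^bsub>R\<^esub> J) R"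
proof (rule subringI)
  interpret J: ideal J R by fact
  note K = subringE[OF assms(1)]
  have Kc: "k \<in> carrier R" if "k \<in> K" for k
    using that K(1) by blast
  have mem: "x \<in> K <+>\<^bsub>R\<^esub> J \<longleftrightarrow> (\<exists>k\<in>K. \<exists>j\<in>J. x = k \<oplus> j)" for x
    by (auto simp: set_add_def')
  show "K <+>\<^bsub>R\<^esub> J \<subseteq> carrier R"
    using Kc J.Icarr by (auto simp: mem)
  show "\<one> \<in> K <+>\<^bsub>R\<^esub> J"
    unfolding mem using K(3) by (intro bexI[of _ \<one>] bexI[of _ \<zero>]) auto
  fix a assume "a \<in> K <+>\<^bsub>R\<^esub> J"
  then obtain k j where a: "k \<in> K" "j \<in> J" "a = k \<oplus> j"
    unfolding mem by blast
  show "\<ominus> a \<in> K <+>\<^bsub>R\<^esub> J"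
    unfolding mem using a K(5) Kc J.Icarr
    by (intro bexI[of _ "\<ominus> k"] bexI[of _ "\<ominus> j"]) (auto simp: minus_add)
  fix b assume "b \<in> K <+>\<^bsub>R\<^esub> J"
  then obtain l i where b: "l \<in> K" "i \<in> J" "b = l \<oplus> i"
    unfolding mem by blast
  note cl = Kc[OF a(1)] J.Icarr[OF a(2)] Kc[OF b(1)] J.Icarr[OF b(2)]
  have "a \<oplus> b = (k \<oplus> l) \<oplus> (j \<oplus> i)"
    unfolding a b using cl by (simp add: a_ac)
  then show "a \<oplus> b \<in> K <+>\<^bsub>R\<^esub> J"
    unfolding mem using a b K(7) J.a_closed by blast
  have "a \<otimes> b = k \<otimes> l \<oplus> (k \<otimes> i \<oplus> j \<otimes> b)"
    unfolding a b using cl by (simp add: l_distr r_distr a_ac)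
  moreover have "k \<otimes> i \<oplus> j \<otimes> b \<in> J"
    using a b cl by (simp add: J.I_l_closed J.I_r_closed)
  ultimately show "a \<otimes> b \<in> K <+>\<^bsub>R\<^esub> J"
    unfolding mem using a b K(6) by blast
qed

section \<open>Initial liftings\<close>

context square_zero_thickening
begin

text \<open>Since \<open>J\<close> is contained in \<open>\<mm>\<close>, a sum
  \<open>k \<oplus> j\<close> in \<open>\<mm>\<close> has \<open>k\<close> in \<open>\<mm>\<close>,
  so adding \<open>J\<close> creates no intersection with \<open>\<mm>\<close> outside
  \<open>J\<close>.\<close>

lemma lifting_add_ideal:
  assumes "subring K R" and K: "K \<inter> \<mm> \<subseteq> J"
  shows "lifting (K <+>\<^bsub>R\<^esub> J)"
  unfolding lifting_def
proof (intro conjI subsetI)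
  note K' = subringE[OF assms(1)]
  show "subring (K <+>\<^bsub>R\<^esub> J) R"
    by (rule subring_add_ideal[OF assms(1) J.ideal_axioms])
  show "x \<in> K <+>\<^bsub>R\<^esub> J" if "x \<in> J" for x
    using that K'(2) J.Icarr[OF that] by (force simp: set_add_def')
  fix x assume x: "x \<in> (K <+>\<^bsub>R\<^esub> J) \<inter> \<mm>"
  then obtain k j where kj: "k \<in> K" "j \<in> J" "x = k \<oplus> j"
    by (auto simp: set_add_def')
  then have "k \<in> \<mm>"
    using ideal_add_cancel[OF \<mm>.ideal_axioms, of k j] x K'(1) J_subset by blast
  then show "x \<in> J"
    using kj K by auto
qed

text \<open>The two alternatives are equal characteristic zero and \<open>p\<close>. In the second,
  \<open>p\<close> vanishes in the ring itself and not only modulo \<open>\<mm>\<close>, which makes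
  the \<open>p\<close>-th powers a subring. The initial lifting is enlarged to a maximal
  one.\<close>

lemma ex_surj_lifting:
  assumes char: "(\<forall>n::nat. 0 < n \<longrightarrow> [n] \<cdot> \<one> \<notin> \<mm>) \<or>
    (\<exists>p::nat. Factorial_Ring.prime p \<and> [p] \<cdot> \<one> = \<zero> \<and> (\<forall>n. 0 < n \<longrightarrow> n < p \<longrightarrow> [n] \<cdot> \<one> \<notin> \<mm>))"
  shows "\<exists>B. lifting B \<and> (\<forall>a\<in>carrier R. \<exists>x\<in>\<mm>. \<exists>b\<in>B. a = x \<oplus> b)"
proof -
  have "\<exists>P. lifting P \<and> (\<forall>d::nat. d > 0 \<longrightarrow> [d] \<cdot> \<one> \<in> \<mm> \<longrightarrow>
      (\<exists>p>0. p \<le> d \<and> (\<forall>x\<in>carrier R. x [^] p \<in> P)))"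
    using char
  proof
    assume zero: "\<forall>n::nat. 0 < n \<longrightarrow> [n] \<cdot> \<one> \<notin> \<mm>"
    \<comment> \<open>The image of the integers meets \<open>\<mm>\<close> only in zero, and the
      condition on powers is vacuous because no positive multiple of \<open>\<one>\<close> is in
      \<open>\<mm>\<close>.\<close>
    have "range (\<lambda>n::int. [n] \<cdot> \<one>) \<inter> \<mm> \<subseteq> J"
    proof
      fix k assume "k \<in> range (\<lambda>n::int. [n] \<cdot> \<one>) \<inter> \<mm>"
      then obtain n :: int where n: "k = [n] \<cdot> \<one>" "[n] \<cdot> \<one> \<in> \<mm>"
        by blast
      have "n = 0"
      proof (rule ccontr)
        assume "n \<noteq> 0"
        then consider "n > 0" | "n < 0" by linarith
        then show False
        proof cases
          case 1
          then show False
            using zero n(2) by (simp add: add_pow_int_ge)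
        next
          case 2
          then have "\<ominus> ([n] \<cdot> \<one>) = [(nat (- n))] \<cdot> \<one>"
            by (simp add: add_pow_int_lt)
          then have "[(nat (- n))] \<cdot> \<one> \<in> \<mm>"
            using n(2) \<mm>.a_inv_closed by metis
          then show False
            using zero 2 by simp
        qed
      qed
      then show "k \<in> J"
        using n(1) by (simp add: add_pow_int_ge)
    qed
    then show ?thesis
      using lifting_add_ideal[OF subring_range_int] zero by blast
  next
    assume "\<exists>p::nat. Factorial_Ring.prime p \<and> [p] \<cdot> \<one> = \<zero> \<and> (\<forall>n. 0 < n \<longrightarrow> n < p \<longrightarrow> [n] \<cdot> \<one> \<notin> \<mm>)"
    then obtain p :: nat where p: "Factorial_Ring.prime p" "[p] \<cdot> \<one> = \<zero>"
      "\<And>n. 0 < n \<Longrightarrow> n < p \<Longrightarrow> [n] \<cdot> \<one> \<notin> \<mm>"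
      by blast
    let ?K = "(\<lambda>x. x [^] p) ` carrier R"
    note K = subring_nat_pow_image[OF p(1,2)]
    have "?K \<inter> \<mm> \<subseteq> J"
    proof
      fix k assume "k \<in> ?K \<inter> \<mm>"
      then obtain x where x: "x \<in> carrier R" "k = x [^] p" "x [^] p \<in> \<mm>"
        by blast
      \<comment> \<open>Once \<open>x\<close> is in \<open>\<mm>\<close>, the bound
        \<open>p \<ge> 2\<close> lets a factor \<open>x \<otimes> x\<close>, an element of
        \<open>J\<close>, be split off from the power.\<close>
      then have xm: "x \<in> \<mm>"
        using nat_pow_notin by blast
      obtain q where "p = q + 2"
        using prime_ge_2_nat[OF p(1)] nat_le_iff_add[of 2 p] by (auto simp: add.commute)
      then have "x [^] p = x [^] q \<otimes> (x \<otimes> x)"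
        using x(1) by (simp add: m_assoc)
      then show "k \<in> J"
        using x square[OF xm xm] by (simp add: J.I_l_closed)
    qed
    then have "lifting (?K <+>\<^bsub>R\<^esub> J)"
      by (rule lifting_add_ideal[OF K])
    moreover have "x [^] p \<in> ?K <+>\<^bsub>R\<^esub> J" if "x \<in> carrier R" for x
    proof -
      have "x [^] p \<oplus> \<zero> \<in> ?K <+>\<^bsub>R\<^esub> J"
        unfolding set_add_def' using imageI[OF that, of "\<lambda>x. x [^] p"] J.zero_closed
        by (intro UN_I[of "x [^] p"] UN_I[of \<zero>]) simp_all
      then show ?thesis
        using that by simp
    qed
    moreover have "p \<le> d" if "d > 0" "[d] \<cdot> \<one> \<in> \<mm>" for d
      using p(3)[OF that(1)] that(2) by (meson not_less)
    moreover have "p > 0"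
      using p(1) by (simp add: prime_gt_0_nat)
    ultimately show ?thesis
      by meson
  qed
  then obtain P where P: "lifting P" "\<And>d::nat. d > 0 \<Longrightarrow> [d] \<cdot> \<one> \<in> \<mm> \<Longrightarrow>
      \<exists>p>0. p \<le> d \<and> (\<forall>x\<in>carrier R. x [^] p \<in> P)"
    by blast
  obtain B where B: "lifting B" "P \<subseteq> B" "\<And>C. lifting C \<Longrightarrow> B \<subseteq> C \<Longrightarrow> C = B"
    using ex_maximal_lifting[OF P(1)] by blast
  have pow: "\<exists>p>0. p \<le> d \<and> (\<forall>x\<in>carrier R. x [^] p \<in> B)"
    if "d > 0" "[d] \<cdot> \<one> \<in> \<mm>" for d :: nat
    using P(2)[OF that] B(2) by auto
  have "\<exists>x\<in>\<mm>. \<exists>b\<in>B. a = x \<oplus> b" if "a \<in> carrier R" for a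
    by (rule maximal_lifting_surj[OF B(1,3) pow that])
  then show ?thesis
    using B(1) by blast
qed

end

section \<open>Coefficient fields\<close>

lemma characteristic_eq_0D:
  assumes "characteristic R = 0" and "n > 0"
  shows "[(n::nat)] \<cdot>\<^bsub>R\<^esub> \<one>\<^bsub>R\<^esub> \<noteq> \<zero>\<^bsub>R\<^esub>"
proof
  let ?P = "\<lambda>n::nat. n > 0 \<and> [n] \<cdot>\<^bsub>R\<^esub> \<one>\<^bsub>R\<^esub> = \<zero>\<^bsub>R\<^esub>"
  assume "[n] \<cdot>\<^bsub>R\<^esub> \<one>\<^bsub>R\<^esub> = \<zero>\<^bsub>R\<^esub>"
  then have ex: "\<exists>n. ?P n"
    using assms(2) by blast
  then have "characteristic R = (LEAST n. ?P n)"
    unfolding characteristic_def by (rule if_P)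
  then show False
    using LeastI_ex[OF ex] assms(1) by simp
qed

lemma characteristic_gt_0D:
  assumes "characteristic R > 0"
  shows "[(characteristic R)] \<cdot>\<^bsub>R\<^esub> \<one>\<^bsub>R\<^esub> = \<zero>\<^bsub>R\<^esub>"
    and "\<lbrakk>0 < n; n < characteristic R\<rbrakk> \<Longrightarrow> [(n::nat)] \<cdot>\<^bsub>R\<^esub> \<one>\<^bsub>R\<^esub> \<noteq> \<zero>\<^bsub>R\<^esub>"
proof -
  let ?P = "\<lambda>n::nat. n > 0 \<and> [n] \<cdot>\<^bsub>R\<^esub> \<one>\<^bsub>R\<^esub> = \<zero>\<^bsub>R\<^esub>"
  have ex: "\<exists>n. ?P n"
  proof (rule ccontr)
    assume "\<not> (\<exists>n. ?P n)"
    then have "characteristic R = 0"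
      unfolding characteristic_def by (rule if_not_P)
    then show False
      using assms by simp
  qed
  then have eq: "characteristic R = (LEAST n. ?P n)"
    unfolding characteristic_def by (rule if_P)
  show "[(characteristic R)] \<cdot>\<^bsub>R\<^esub> \<one>\<^bsub>R\<^esub> = \<zero>\<^bsub>R\<^esub>"
    unfolding eq using LeastI_ex[OF ex] by blast
  show "[n] \<cdot>\<^bsub>R\<^esub> \<one>\<^bsub>R\<^esub> \<noteq> \<zero>\<^bsub>R\<^esub>" if "0 < n" "n < characteristic R" for n :: nat
    using not_less_Least[of n ?P] that unfolding eq by blast
qed

lemma (in ideal) quotient_add_pow_one:
  "[(n::nat)] \<cdot>\<^bsub>R Quot I\<^esub> \<one>\<^bsub>R Quot I\<^esub> = \<zero>\<^bsub>R Quot I\<^esub> \<longleftrightarrow> [n] \<cdot> \<one> \<in> I"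
proof -
  have "[n] \<cdot>\<^bsub>R Quot I\<^esub> \<one>\<^bsub>R Quot I\<^esub> = I +> ([n] \<cdot> \<one>)"
  proof (induction n)
    case 0
    show ?case
      using a_rcos_zero[OF ideal_axioms, of \<zero>]
      by (simp add: add_pow_def nat_pow_def FactRing_def)
  next
    case (Suc n)
    have "[Suc n] \<cdot>\<^bsub>R Quot I\<^esub> \<one>\<^bsub>R Quot I\<^esub> = (I +> ([n] \<cdot> \<one>)) <+> (I +> \<one>)"
      using Suc by (simp add: add_pow_def nat_pow_def FactRing_def)
    then show ?case
      using a_rcos_sum[of "[n] \<cdot> \<one>" \<one>] by simp
  qed
  moreover have "I +> ([n] \<cdot> \<one>) = I \<longleftrightarrow> [n] \<cdot> \<one> \<in> I"
    using rcos_const_imp_mem[of "[n] \<cdot> \<one>"] a_rcos_zero[OF ideal_axioms] by auto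
  ultimately show ?thesis
    by (simp add: FactRing_def)
qed

text \<open>A nonzero common characteristic \<open>p\<close> vanishes in \<open>R\<close> and is
  minimal modulo \<open>I\<close>. A proper factorisation of \<open>p\<close> would put a smaller
  positive multiple of \<open>\<one>\<close> into the prime ideal \<open>I\<close>, so
  \<open>p\<close> is prime.\<close>

lemma (in primeideal) equicharacteristic_cases:
  assumes "equicharacteristic R I"
  shows "(\<forall>n::nat. 0 < n \<longrightarrow> [n] \<cdot> \<one> \<notin> I) \<or>
    (\<exists>p::nat. Factorial_Ring.prime p \<and> [p] \<cdot> \<one> = \<zero> \<and>
      (\<forall>n. 0 < n \<longrightarrow> n < p \<longrightarrow> [n] \<cdot> \<one> \<notin> I))"
proof (cases "characteristic R = 0")
  case True
  then have "characteristic (R Quot I) = 0"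
    using assms by (simp add: equicharacteristic_def)
  then show ?thesis
    using characteristic_eq_0D quotient_add_pow_one by blast
next
  case False
  define p where "p = characteristic R"
  have p0: "p > 0" and q: "characteristic (R Quot I) = p"
    using assms False by (auto simp: p_def equicharacteristic_def)
  have zero: "[p] \<cdot> \<one> = \<zero>"
    using characteristic_gt_0D(1)[of R] p0 by (simp add: p_def)
  have small: "[n] \<cdot> \<one> \<notin> I" if "0 < n" "n < p" for n :: nat
    using characteristic_gt_0D(2)[of "R Quot I" n] q that quotient_add_pow_one by simp
  have "\<one> \<notin> I"
    using one_imp_carrier I_notcarr by blast
  then have "p \<noteq> 1"
    using zero by (auto intro: ccontr)
  have "Factorial_Ring.prime p"
  proof (rule ccontr)
    assume "\<not> Factorial_Ring.prime p"
    then obtain a where a: "a dvd p" "a \<noteq> 1" "a \<noteq> p"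
      using \<open>p \<noteq> 1\<close> p0 unfolding prime_nat_iff by auto
    then obtain b where ab: "p = a * b"
      by (elim dvdE)
    then have pos: "a > 0" "b > 0"
      using p0 by auto
    have less: "a < p" "b < p"
      using a pos ab by (auto intro: le_neq_implies_less)
    have "([a] \<cdot> \<one>) \<otimes> ([b] \<cdot> \<one>) \<in> I"
      using zero ab by (simp add: add_pow_one_mult)
    then have "[a] \<cdot> \<one> \<in> I \<or> [b] \<cdot> \<one> \<in> I"
      by (intro I_prime) auto
    then show False
      using small less pos by blast
  qed
  then show ?thesis
    using zero small by blast
qed

text \<open>A nonunit generates a proper ideal, and a maximal ideal above it must be
  \<open>\<mm>\<close>. The Noetherian condition provides the upper bounds for Zorn's lemma: the
  union of a nonempty chain of ideals is one of its members.\<close>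

lemma (in cring) local_ring_unit:
  assumes "noetherian_ring R" "local_ring R \<mm>" and x: "x \<in> carrier R" "x \<notin> \<mm>"
  shows "x \<in> Units R"
proof (rule ccontr)
  interpret noetherian_ring R by fact
  assume nu: "x \<notin> Units R"
  let ?F = "{I. ideal I R \<and> x \<in> I \<and> \<one> \<notin> I}"
  have "\<one> \<notin> PIdl x"
  proof
    assume "\<one> \<in> PIdl x"
    then obtain y where "y \<in> carrier R" "\<one> = y \<otimes> x"
      unfolding cgenideal_def by blast
    then have "x \<in> Units R"
      using x(1) m_comm[of x y] unfolding Units_def by auto
    then show False
      using nu by simp
  qed
  then have ne: "PIdl x \<in> ?F"
    using cgenideal_ideal[OF x(1)] cgenideal_self[OF x(1)] by simp
  have "\<exists>M\<in>?F. \<forall>N\<in>?F. M \<subseteq> N \<longrightarrow> N = M"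
  proof (rule subset_Zorn_nonempty)
    show "?F \<noteq> {}"
      using ne by blast
    fix \<C> assume "\<C> \<noteq> {}" and ch: "subset.chain ?F \<C>"
    moreover from ch have "subset.chain {I. ideal I R} \<C>"
      unfolding pred_on.chain_def by auto
    ultimately have "\<Union>\<C> \<in> \<C>"
      using ideal_chain_is_trivial by blast
    then show "\<Union>\<C> \<in> ?F"
      using ch unfolding pred_on.chain_def by blast
  qed
  then obtain M where M: "M \<in> ?F" "\<forall>N\<in>?F. M \<subseteq> N \<longrightarrow> N = M"
    by (elim bexE)
  have "maximalideal M R"
  proof (rule maximalidealI)
    show "ideal M R" "carrier R \<noteq> M"
      using M(1) by auto
    fix N assume N: "ideal N R" "M \<subseteq> N" "N \<subseteq> carrier R"
    show "N = M \<or> N = carrier R"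
    proof (cases "\<one> \<in> N")
      case True
      then show ?thesis
        using ideal.one_imp_carrier[OF N(1)] by simp
    next
      case False
      then have "N \<in> ?F"
        using N M(1) by auto
      then show ?thesis
        using bspec[OF M(2), of N] N(2) by blast
    qed
  qed
  then have "M = \<mm>"
    using assms(2) by (simp add: local_ring_iff_maximalideal)
  then show False
    using M(1) x(2) by simp
qed

section \<open>The descending chain of subrings and its intersection\<close>

context cring
begin

text \<open>Write \<open>inv x = y \<oplus> b\<close> with \<open>y\<close> in \<open>\<mm>\<close>
  and \<open>b\<close> in \<open>A\<close>. Then
  \<open>x \<otimes> y = \<one> \<ominus> x \<otimes> b\<close> lies in
  \<open>A \<inter> \<mm>\<close>. As this is an ideal of all of \<open>R\<close>, multiplying by
  \<open>inv x\<close> puts \<open>y\<close> into \<open>A\<close> as well.\<close>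

lemma inv_mem_subring:
  assumes A: "subring A R" and I: "ideal (A \<inter> \<mm>) R"
    and surj: "\<And>a. a \<in> carrier R \<Longrightarrow> \<exists>x\<in>\<mm>. \<exists>b\<in>A. a = x \<oplus> b"
    and \<mm>: "ideal \<mm> R" and x: "x \<in> A" "x \<in> Units R"
  shows "inv x \<in> A"
proof -
  note A' = subringE[OF A]
  obtain y b where yb: "y \<in> \<mm>" "b \<in> A" "inv x = y \<oplus> b"
    using surj[of "inv x"] x(2) by blast
  have cl: "x \<in> carrier R" "y \<in> carrier R" "b \<in> carrier R"
    using x yb A'(1) ideal.Icarr[OF \<mm>] by auto
  have "x \<otimes> y = x \<otimes> (y \<oplus> b) \<oplus> \<ominus> (x \<otimes> b)"
    using cl by algebra
  also have "\<dots> = \<one> \<oplus> \<ominus> (x \<otimes> b)"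
    using yb(3) x(2) by (simp flip: yb(3))
  finally have "x \<otimes> y \<in> A"
    using A'(3,5,6,7) x(1) yb(2) by simp
  then have "x \<otimes> y \<in> A \<inter> \<mm>"
    using ideal.I_l_closed[OF \<mm> yb(1) cl(1)] by simp
  then have "inv x \<otimes> (x \<otimes> y) \<in> A \<inter> \<mm>"
    using ideal.I_l_closed[OF I] x(2) by blast
  moreover have "inv x \<otimes> (x \<otimes> y) = y"
    using x(2) cl m_assoc[of "inv x" x y] by simp
  ultimately show ?thesis
    using yb A'(7) by simp
qed

text \<open>The ring \<open>A\<close> is local with maximal ideal \<open>A \<inter> \<mm>\<close>, whose square lies in \<open>J\<close>, so a lifting in \<open>A\<close>
  modulo \<open>J\<close> still covers all residue classes of \<open>R\<close>.\<close>

lemma refine_subring: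
  assumes \<mm>: "ideal \<mm> R" "\<one> \<notin> \<mm>" "\<And>x. x \<in> carrier R \<Longrightarrow> x \<notin> \<mm> \<Longrightarrow> x \<in> Units R"
    and char: "(\<forall>n::nat. 0 < n \<longrightarrow> [n] \<cdot> \<one> \<notin> \<mm>) \<or>
      (\<exists>p::nat. Factorial_Ring.prime p \<and> [p] \<cdot> \<one> = \<zero> \<and>
        (\<forall>n. 0 < n \<longrightarrow> n < p \<longrightarrow> [n] \<cdot> \<one> \<notin> \<mm>))"
    and A: "subring A R" and surj: "\<forall>a\<in>carrier R. \<exists>x\<in>\<mm>. \<exists>b\<in>A. a = x \<oplus> b"
    and I: "ideal (A \<inter> \<mm>) R" and J: "ideal J R" "J \<subseteq> A \<inter> \<mm>"
    and square: "\<And>x y. x \<in> A \<inter> \<mm> \<Longrightarrow> y \<in> A \<inter> \<mm> \<Longrightarrow> x \<otimes> y \<in> J"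
  shows "\<exists>B. subring B R \<and> B \<subseteq> A \<and> B \<inter> \<mm> = J \<and> (\<forall>a\<in>carrier R. \<exists>x\<in>\<mm>. \<exists>b\<in>B. a = x \<oplus> b)"
proof -
  let ?A = "R\<lparr>carrier := A\<rparr>"
  note A' = subringE[OF A]
  have cring: "cring ?A"
    using subcringI'[OF A] subcring_iff[OF A'(1)] by simp
  have num: "[n] \<cdot>\<^bsub>?A\<^esub> \<one>\<^bsub>?A\<^esub> = [n] \<cdot> \<one>" for n :: nat
    by (simp add: add_pow_def nat_pow_def)
  have ideal: "ideal K ?A" if K: "ideal K R" "K \<subseteq> A" for K
  proof (rule idealI)
    interpret K: ideal K R by fact
    show "ring ?A"
      by (rule subring_is_ring[OF A])
    show "subgroup K (add_monoid ?A)"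
      using add.subgroup_incl[OF K.a_subgroup subring.axioms(1)[OF A] K(2)] by simp
    show "x \<otimes>\<^bsub>?A\<^esub> a \<in> K" "a \<otimes>\<^bsub>?A\<^esub> x \<in> K" if "a \<in> K" "x \<in> carrier ?A" for a x
      using that A'(1) K.I_l_closed K.I_r_closed by auto
  qed
  interpret S: square_zero_thickening ?A "A \<inter> \<mm>" J
  proof (intro square_zero_thickening.intro square_zero_thickening_axioms.intro cring)
    show "ideal (A \<inter> \<mm>) ?A" "ideal J ?A"
      using ideal[OF I] ideal[OF J(1)] J(2) by auto
    show "\<one>\<^bsub>?A\<^esub> \<notin> A \<inter> \<mm>" "J \<subseteq> A \<inter> \<mm>"
      using \<mm>(2) J(2) by auto
    show "x \<otimes>\<^bsub>?A\<^esub> y \<in> J" if "x \<in> A \<inter> \<mm>" "y \<in> A \<inter> \<mm>" for x y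
      using square[OF that] by simp
    fix x assume "x \<in> carrier ?A" "x \<notin> A \<inter> \<mm>"
    then have x: "x \<in> A" "x \<in> carrier R" "x \<in> Units R"
      using A'(1) \<mm>(3) by auto
    then have "inv x \<in> A"
      using inv_mem_subring[OF A I _ \<mm>(1)] surj by blast
    then show "x \<in> Units ?A"
      using x by (auto simp: Units_def[of ?A] intro!: bexI[of _ "inv x"])
  qed
  have "(\<forall>n::nat. 0 < n \<longrightarrow> [n] \<cdot>\<^bsub>?A\<^esub> \<one>\<^bsub>?A\<^esub> \<notin> A \<inter> \<mm>) \<or>
      (\<exists>p::nat. Factorial_Ring.prime p \<and> [p] \<cdot>\<^bsub>?A\<^esub> \<one>\<^bsub>?A\<^esub> = \<zero>\<^bsub>?A\<^esub> \<and>
        (\<forall>n. 0 < n \<longrightarrow> n < p \<longrightarrow> [n] \<cdot>\<^bsub>?A\<^esub> \<one>\<^bsub>?A\<^esub> \<notin> A \<inter> \<mm>))"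
    unfolding num using char by auto
  then obtain B where B: "S.lifting B"
    and surjB: "\<forall>a\<in>carrier ?A. \<exists>x\<in>A \<inter> \<mm>. \<exists>b\<in>B. a = x \<oplus>\<^bsub>?A\<^esub> b"
    using S.ex_surj_lifting by blast
  have BA: "B \<subseteq> A"
    using subringE(1)[OF S.liftingD(1)[OF B]] by simp
  have "subring B R"
    using ring_incl_imp_subring[of B] S.subring_is_ring[OF S.liftingD(1)[OF B]] BA A'(1) by simp
  moreover have "B \<inter> \<mm> = J"
    using B BA J(2) by (auto simp: S.lifting_def)
  moreover have "\<exists>x\<in>\<mm>. \<exists>b\<in>B. a = x \<oplus> b" if "a \<in> carrier R" for a
  proof -
    obtain x b where x: "x \<in> \<mm>" "b \<in> A" "a = x \<oplus> b"
      using surj \<open>a \<in> carrier R\<close> by blast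
    obtain y c where y: "y \<in> A \<inter> \<mm>" "c \<in> B" "b = y \<oplus> c"
      using surjB x(2) by auto
    have "x \<in> carrier R" "y \<in> carrier R" "c \<in> carrier R"
      using x y BA A'(1) ideal.Icarr[OF \<mm>(1)] by auto
    then have "a = (x \<oplus> y) \<oplus> c"
      using x(3) y(3) by (simp add: a_assoc)
    moreover have "x \<oplus> y \<in> \<mm>"
      using x y \<mm>(1) by (simp add: additive_subgroup.a_closed ideal.axioms(1))
    ultimately show ?thesis
      using y(2) by blast
  qed
  ultimately show ?thesis
    using BA by blast
qed

lemma ideal_power_ideal:
  assumes "ideal I R"
  shows "ideal (ideal_power R I n) R"
  by (induction n) (simp_all only: ideal_power_0 ideal_power_Suc oneideal ideal_prod_is_ideal assms)

lemma ideal_power_Suc_subset: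
  assumes "ideal I R"
  shows "ideal_power R I (Suc n) \<subseteq> ideal_power R I n" "ideal_power R I (Suc n) \<subseteq> I"
  unfolding ideal_power_Suc
  using ideal_prod_inter[OF ideal_power_ideal[OF assms, of n] assms] by blast+

text \<open>Powers start from the whole ring, so the first power is the product of
  \<open>carrier R\<close> with \<open>I\<close>.\<close>

lemma ideal_power_1:
  assumes "ideal I R"
  shows "ideal_power R I (Suc 0) = I"
proof
  show "I \<subseteq> ideal_power R I (Suc 0)"
  proof
    fix x assume x: "x \<in> I"
    then have "\<one> \<otimes> x \<in> carrier R \<cdot> I"
      by (intro ideal_prod.prod) auto
    then show "x \<in> ideal_power R I (Suc 0)"
      unfolding ideal_power_Suc ideal_power_0 using x ideal.Icarr[OF assms] by simp
  qed
qed (rule ideal_power_Suc_subset[OF assms])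

lemma complete_equicharacteristic_class_A:
  assumes noeth: "noetherian_ring R" and loc: "local_ring R \<mm>"
    and complete: "adically_complete R \<mm>" and equichar: "equicharacteristic R \<mm>"
  shows "class_A R \<mm>"
proof -
  have "maximalideal \<mm> R"
    using loc by (simp add: local_ring_iff_maximalideal)
  then interpret \<mm>: maximalideal \<mm> R .
  interpret \<mm>: primeideal \<mm> R
    by (rule maximalideal_prime) fact
  note unit = local_ring_unit[OF noeth loc]
  have one: "\<one> \<notin> \<mm>"
    using \<mm>.one_imp_carrier \<mm>.I_notcarr by blast
  then have one_zero: "\<one> \<noteq> \<zero>"
    using \<mm>.zero_closed by metis
  let ?P = "ideal_power R \<mm>"
  note P_ideal = ideal_power_ideal[OF \<mm>.ideal_axioms]
  note P_Suc = ideal_power_Suc_subset[OF \<mm>.ideal_axioms]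
  \<comment> \<open>The exponent is \<open>Suc n\<close> so that the chain can start with the whole
    ring, whose intersection with \<open>\<mm>\<close> is the first power.\<close>
  define Q where "Q n A \<longleftrightarrow> subring A R \<and> A \<inter> \<mm> = ?P (Suc n) \<and>
    (\<forall>a\<in>carrier R. \<exists>x\<in>\<mm>. \<exists>b\<in>A. a = x \<oplus> b)" for n A
  have "\<exists>f. \<forall>n. Q n (f n) \<and> f (Suc n) \<subseteq> f n"
  proof (rule dependent_nat_choice)
    have "\<forall>a\<in>carrier R. \<exists>x\<in>\<mm>. \<exists>b\<in>carrier R. a = x \<oplus> b"
      using \<mm>.zero_closed by (metis l_zero)
    then show "\<exists>A. Q 0 A"
      using carrier_is_subring ideal_power_1[OF \<mm>.ideal_axioms] \<mm>.Icarr
      by (intro exI[of _ "carrier R"]) (auto simp: Q_def)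
    fix A n assume "Q n A"
    then have A: "subring A R" "A \<inter> \<mm> = ?P (Suc n)" "\<forall>a\<in>carrier R. \<exists>x\<in>\<mm>. \<exists>b\<in>A. a = x \<oplus> b"
      by (auto simp: Q_def)
    \<comment> \<open>For \<open>x\<close> membership in \<open>?P (Suc n)\<close> is used, for
      \<open>y\<close> only membership in \<open>\<mm>\<close>.\<close>
    have square: "x \<otimes> y \<in> ?P (Suc (Suc n))" if "x \<in> A \<inter> \<mm>" "y \<in> A \<inter> \<mm>" for x y
      unfolding ideal_power_Suc[of R \<mm> "Suc n"] using that A(2)
      by (intro ideal_prod.prod) auto
    have "ideal (A \<inter> \<mm>) R" "?P (Suc (Suc n)) \<subseteq> A \<inter> \<mm>"
      unfolding A(2) by (rule P_ideal, rule P_Suc)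
    then have "\<exists>B. subring B R \<and> B \<subseteq> A \<and> B \<inter> \<mm> = ?P (Suc (Suc n)) \<and>
        (\<forall>a\<in>carrier R. \<exists>x\<in>\<mm>. \<exists>b\<in>B. a = x \<oplus> b)"
      by (intro refine_subring[OF \<mm>.ideal_axioms one _ \<mm>.equicharacteristic_cases[OF equichar]
            A(1,3) _ P_ideal]) (assumption | rule unit square)+
    then show "\<exists>B. Q (Suc n) B \<and> B \<subseteq> A"
      unfolding Q_def by (elim exE conjE) (intro exI conjI, assumption+)
  qed
  then obtain A where A: "Q n (A n)" "A (Suc n) \<subseteq> A n" for n
    by blast
  note sub = A(1)[unfolded Q_def, THEN conjunct1]
  have Am: "A n \<inter> \<mm> = ?P (Suc n)" for n
    using A(1)[of n] by (simp add: Q_def)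
  have surj: "\<exists>x\<in>\<mm>. \<exists>b\<in>A n. a = x \<oplus> b" if "a \<in> carrier R" for a n
    using A(1)[of n] that by (simp add: Q_def)
  have anti: "A n \<subseteq> A m" if "m \<le> n" for m n
    using lift_Suc_antimono_le[of A] A(2) that by blast
  have separated: "(\<Inter>n. ?P n) = {\<zero>}"
    using complete by (simp add: adically_complete_def adically_separated_def)
  define \<kappa> where "\<kappa> = (\<Inter>n. A n)"
  have \<kappa>_sub: "subring \<kappa> R"
    unfolding \<kappa>_def by (rule subring_Inter) (use sub in auto)
  have \<kappa>_inter: "x = \<zero>" if "x \<in> \<kappa>" "x \<in> \<mm>" for x
  proof -
    have "x \<in> ?P (Suc n)" for n
      using that Am[of n] by (auto simp: \<kappa>_def)
    then have "x \<in> (\<Inter>n. ?P n)"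
      using P_Suc(1) by blast
    then show ?thesis
      using separated by simp
  qed
  have \<kappa>_unit: "x \<in> Units R" "inv x \<in> \<kappa>" if "x \<in> \<kappa>" "x \<noteq> \<zero>" for x
  proof -
    show u: "x \<in> Units R"
      using that \<kappa>_inter unit subringE(1)[OF \<kappa>_sub] by blast
    \<comment> \<open>Inverses stay in each \<open>A n\<close> separately, hence in the
      intersection.\<close>
    have "inv x \<in> A n" for n
    proof (rule inv_mem_subring[OF sub _ surj \<mm>.ideal_axioms _ u])
      show "ideal (A n \<inter> \<mm>) R"
        unfolding Am by (rule P_ideal)
    qed (use that in \<open>auto simp: \<kappa>_def\<close>)
    then show "inv x \<in> \<kappa>"
      by (simp add: \<kappa>_def)
  qed
  have subfield: "subfield \<kappa> R"
  proof (rule subfieldI)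
    show "subcring \<kappa> R"
      by (rule subcringI'[OF \<kappa>_sub])
    show "Units (R\<lparr>carrier := \<kappa>\<rparr>) = \<kappa> - {\<zero>}"
    proof
      show "Units (R\<lparr>carrier := \<kappa>\<rparr>) \<subseteq> \<kappa> - {\<zero>}"
        using one_zero subsetD[OF subringE(1)[OF \<kappa>_sub]] by (auto simp: Units_def)
      show "\<kappa> - {\<zero>} \<subseteq> Units (R\<lparr>carrier := \<kappa>\<rparr>)"
      proof
        fix x assume x: "x \<in> \<kappa> - {\<zero>}"
        then show "x \<in> Units (R\<lparr>carrier := \<kappa>\<rparr>)"
          using \<kappa>_unit[of x] by (auto simp: Units_def[of "R\<lparr>carrier := \<kappa>\<rparr>"] intro!: bexI[of _ "inv x"])
      qed
    qed
  qed
  have decomp: "\<exists>x\<in>\<mm>. \<exists>u\<in>\<kappa>. r = x \<oplus> u" if r: "r \<in> carrier R" for r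
  proof -
    have "\<forall>n. \<exists>b. b \<in> A n \<and> (\<exists>x\<in>\<mm>. r = x \<oplus> b)"
      using surj[OF r] by blast
    then obtain s where s: "\<And>n. s n \<in> A n" "\<And>n. \<exists>x\<in>\<mm>. r = x \<oplus> s n"
      by metis
    have sc: "s n \<in> carrier R" for n
      using s(1) subringE(1)[OF sub] by blast
    \<comment> \<open>Both terms represent the class of \<open>r\<close>, so the difference is in
      \<open>\<mm>\<close>. Both lie in \<open>A n\<close> because the chain decreases, and
      \<open>A n\<close> meets \<open>\<mm>\<close> in \<open>?P (Suc n)\<close>.\<close>
    have diff: "s i \<ominus> s j \<in> ?P (Suc n)" if "n \<le> i" "n \<le> j" for i j n
    proof -
      obtain x where x: "x \<in> \<mm>" "r = x \<oplus> s i"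
        using s(2)[of i] by (elim bexE)
      obtain y where y: "y \<in> \<mm>" "r = y \<oplus> s j"
        using s(2)[of j] by (elim bexE)
      note cl = \<mm>.Icarr[OF x(1)] \<mm>.Icarr[OF y(1)] sc[of i] sc[of j]
      have "s i \<ominus> s j = (x \<oplus> s i) \<oplus> \<ominus> x \<oplus> \<ominus> s j"
        using cl by algebra
      also have "\<dots> = (y \<oplus> s j) \<oplus> \<ominus> x \<oplus> \<ominus> s j"
        unfolding x(2)[symmetric] y(2) ..
      also have "\<dots> = y \<oplus> \<ominus> x"
        using cl by algebra
      also have "\<dots> \<in> \<mm>"
        using x(1) y(1) by simp
      finally have "s i \<ominus> s j \<in> \<mm>" .
      moreover have "s i \<in> A n" "s j \<in> A n"
        using s(1) anti that by blast+
      then have "s i \<ominus> s j \<in> A n"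
        using subringE(5,7)[OF sub] by (simp add: a_minus_def)
      ultimately show ?thesis
        using Am by blast
    qed
    have "adic_Cauchy R \<mm> s"
      unfolding adic_Cauchy_def
    proof (intro allI)
      fix k
      show "\<exists>N. \<forall>i\<ge>N. \<forall>j\<ge>N. s i \<ominus> s j \<in> ?P k"
        using diff[of k] P_Suc(1)[of k] by (intro exI[of _ k] allI impI) blast
    qed
    moreover have "range s \<subseteq> carrier R"
      using sc by blast
    ultimately obtain u where u: "u \<in> carrier R" "adic_tendsto R \<mm> s u"
      using complete unfolding adically_complete_def by blast
    have near: "\<exists>i\<ge>n. s i \<ominus> u \<in> ?P (Suc n)" for n
    proof -
      obtain N where "\<forall>i\<ge>N. s i \<ominus> u \<in> ?P (Suc n)"
        using u(2) unfolding adic_tendsto_def by blast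
      then show ?thesis
        by (intro exI[of _ "max N n"]) simp
    qed
    have eq: "u = s i \<oplus> \<ominus> (s i \<ominus> u)" for i
      using u(1) sc[of i] by algebra
    \<comment> \<open>Each \<open>A n\<close> contains \<open>?P (Suc n)\<close> and is therefore
      closed in the adic topology. Taking \<open>i \<ge> n\<close> puts \<open>s i\<close> in
      \<open>A n\<close>, and the limit follows.\<close>
    have "u \<in> A n" for n
    proof -
      obtain i where i: "i \<ge> n" "s i \<ominus> u \<in> ?P (Suc n)"
        using near by blast
      then have "s i \<ominus> u \<in> A n" "s i \<in> A n"
        using Am[of n] s(1)[of i] anti[of n i] by blast+
      then have "s i \<oplus> \<ominus> (s i \<ominus> u) \<in> A n"
        using subringE(5,7)[OF sub] by simp
      then show ?thesis
        using eq by simp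
    qed
    then have "u \<in> \<kappa>"
      by (simp add: \<kappa>_def)
    moreover obtain i where i: "s i \<ominus> u \<in> \<mm>"
      using near[of 0] P_Suc(2) by blast
    obtain x where x: "x \<in> \<mm>" "r = x \<oplus> s i"
      using s(2) by blast
    have "r = (x \<oplus> (s i \<ominus> u)) \<oplus> u"
      using x(2) \<mm>.Icarr[OF x(1)] u(1) sc[of i] by algebra
    moreover have "x \<oplus> (s i \<ominus> u) \<in> \<mm>"
      using x(1) i by simp
    ultimately show ?thesis
      by blast
  qed
  show ?thesis
    unfolding class_A_def
  proof (intro conjI exI ballI)
    show "\<exists>x\<in>\<mm>. \<exists>u\<in>\<kappa>. r = x \<oplus> u" if "r \<in> Units R" for r
      by (rule decomp[OF Units_closed[OF that]])
  qed (rule loc subfield)+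
qed

end

theorem proposition3p10:
  fixes R :: "('a, 'b) ring_scheme" and \<mm> :: "'a set"
  assumes "cring R"
    and "noetherian_ring R"
    and "local_ring R \<mm>"
    and "adically_complete R \<mm>"
    and "equicharacteristic R \<mm>"
  shows "class_A R \<mm>"
  by (rule cring.complete_equicharacteristic_class_A[OF assms])

end
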